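(* Let $f_j:\mathbb C\to\mathbb C^{m_j}$, $1\le j\le l$, be exponential maps of maximal transcendence degree, and let $P$, $Q$ be holomorphic polynomial automorphisms of $\mathbb C^l$ and $\mathbb C^{m_1+\cdots+m_l}$, respectively. Set $\bar m:=\max_{1\le j\le l}m_j$ and $F_{P,Q}:=Q\circ(f_1\times\cdots\times f_l)\circ P:\mathbb C^l\to\mathbb C^{m_1+\cdots+m_l}$. Then the graph $\Gamma_{F_{P,Q}}\subset\mathbb C^{l+m_1+\cdots+m_l}$ admits the Bernstein type inequality of exponent $\mu(k)=k^{\bar m+1}$, $k\in\mathbb Z_+$, and this exponent is optimal for $\Gamma_{F_{P,Q}}$.
   Context: $\mathbb Z_+=\{0,1,2,\dots\}$, $\mathbb R_+=[0,\infty)$; $\|\cdot\|$ is the Euclidean norm. A map $f:\mathbb C\to\mathbb C^m$ is exponential of maximal transcendence degree if there are complex numbers $\alpha_1,\dots,\alpha_m$, linearly independent over $\mathbb Q$, such that $f(z)=(e^{\alpha_1z},\dots,e^{\alpha_mz})$, $z\in\mathbb C$. $(f_1\times\cdots\times f_l)(z_1,\dots,z_l):=(f_1(z_1),\dots,f_l(z_l))$. A holomorphic polynomial automorphism of $\mathbb C^N$ is a bijective polynomial map $\mathbb C^N\to\mathbb C^N$ whose inverse is polynomial. The graph $\Gamma_F=\{(z,F(z))\}\subset\mathbb C^{n+m}$ of a holomorphic map $F:\mathbb C^n\to\mathbb C^m$ admits the Bernstein type inequality of exponent $\mu:\mathbb Z_+\to\mathbb R_+$ if for each $r>0$ there is a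 nonnegative constant $C(r)$ such that for all holomorphic polynomials $p$ on $\mathbb C^{n+m}$, $\max_{\|z\|\le er}|p(z,F(z))|\le C(r)^{\mu(\deg p)}\max_{\|z\|\le r}|p(z,F(z))|$. Write $\langle\mu_1\rangle\le\langle\mu_2\rangle$ if $\mu_1\le c\,\mu_2$ on $\mathbb Z_+$ for some $c>0$, where $\langle\mu\rangle$ is the class of $\mu$ under the equivalence $\frac1c\mu_1\le\mu_2\le c\mu_1$ for some $c>0$. An exponent $\mu_o$ is optimal for $\Gamma_F$ if $\langle\mu_o\rangle$ is the minimal element of the set of classes $\langle\mu\rangle$ such that $\Gamma_F$ admits the Bernstein type inequality of exponent $\mu$; in other words, $\Gamma_F$ admits the inequality of exponent $\mu_o$ and does not admit such an inequality of any exponent $\mu$ with $\mu\le c\mu_o$ for some $c>0$ and $\limsup_{k\to\infty}\mu_o(k)/\mu(k)=\infty$. *)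

theory Defs
  imports "HOL-Analysis.Analysis" "HOL-Library.Poly_Mapping"
begin

section \<open>Holomorphic polynomials and polynomial automorphisms\<close>

text \<open>A polynomial with variables indexed by \<open>'v\<close> is a finitely supported map from monomials
  (finitely supported exponent vectors) to complex coefficients.\<close>

type_synonym 'v cpoly = "('v \<Rightarrow>\<^sub>0 nat) \<Rightarrow>\<^sub>0 complex"

definition cpoly_eval :: "('v::finite) cpoly \<Rightarrow> complex ^ 'v \<Rightarrow> complex" where
  "cpoly_eval p x =
     (\<Sum>a \<in> Poly_Mapping.keys p.
        Poly_Mapping.lookup p a * (\<Prod>v\<in>UNIV. (x $ v) ^ Poly_Mapping.lookup a v))"

text \<open>Total degree; the zero polynomial is given degree 0, which is harmless in the Bernstein type
  inequality, as both of its sides vanish for the zero polynomial.\<close>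

definition cpoly_degree :: "('v::finite) cpoly \<Rightarrow> nat" where
  "cpoly_degree p =
     Max (insert 0 ((\<lambda>a. \<Sum>v\<in>UNIV. Poly_Mapping.lookup a v) ` Poly_Mapping.keys p))"

definition polynomial_map :: "(complex ^ ('n::finite) \<Rightarrow> complex ^ ('k::finite)) \<Rightarrow> bool" where
  "polynomial_map G \<longleftrightarrow> (\<exists>p :: 'k \<Rightarrow> 'n cpoly. \<forall>x i. G x $ i = cpoly_eval (p i) x)"

definition polynomial_automorphism :: "(complex ^ ('n::finite) \<Rightarrow> complex ^ 'n) \<Rightarrow> bool" where
  "polynomial_automorphism G \<longleftrightarrow> bij G \<and> polynomial_map G \<and> polynomial_map (inv G)"


section \<open>Exponential maps of maximal transcendence degree\<close>

global_interpretation complex_over_rat: vector_space "\<lambda>(q::rat) (z::complex). of_rat q * z"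
  by unfold_locales (simp_all add: algebra_simps of_rat_add of_rat_mult)

text \<open>The dimensions \<open>m\<^sub>1, \<dots>, m\<^sub>l\<close> vary with the index, so the target \<open>\<complex>\<^sup>m\<close> of a single
  exponential map is rendered by coordinate functions on \<open>{..<m}\<close>; values at indices \<open>\<ge> m\<close> are
  ignored.  Injectivity together with independence of the set of values is linear independence
  of the family.\<close>

definition exponential_max_trdeg :: "nat \<Rightarrow> (complex \<Rightarrow> nat \<Rightarrow> complex) \<Rightarrow> bool" where
  "exponential_max_trdeg m f \<longleftrightarrow>
     (\<exists>\<alpha> :: nat \<Rightarrow> complex.
        inj_on \<alpha> {..<m} \<and> complex_over_rat.independent (\<alpha> ` {..<m}) \<and>
        (\<forall>z. \<forall>i<m. f z i = exp (\<alpha> i * z)))"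

text \<open>The product map \<open>f\<^sub>1 \<times> \<dots> \<times> f\<^sub>l\<close>.  The map \<open>coord\<close> enumerates the coordinates of
  \<open>\<complex>\<^bsup>m\<^sub>1 + \<dots> + m\<^sub>l\<^esup>\<close>: it is meant to be a bijection from the index type \<open>'m\<close> onto the pairs
  \<open>(j, i)\<close> with \<open>i < m\<^sub>j\<close>, and \<open>coord s = (j, i)\<close> says that the coordinate \<open>s\<close> is the \<open>i\<close>-th
  coordinate of the \<open>j\<close>-th factor.\<close>

definition product_map ::
  "('m::finite \<Rightarrow> 'l::finite \<times> nat) \<Rightarrow> ('l \<Rightarrow> complex \<Rightarrow> nat \<Rightarrow> complex) \<Rightarrow> complex ^ 'l \<Rightarrow> complex ^ 'm"
  where "product_map coord f z = (\<chi> s. case coord s of (j, i) \<Rightarrow> f j (z $ j) i)"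


section \<open>Bernstein type inequalities on graphs\<close>

definition graph_point ::
  "(complex ^ ('n::finite) \<Rightarrow> complex ^ ('m::finite)) \<Rightarrow> complex ^ 'n \<Rightarrow> complex ^ ('n + 'm)" where
  "graph_point F z = (\<chi> i. case i of Inl a \<Rightarrow> z $ a | Inr b \<Rightarrow> F z $ b)"

text \<open>The supremum is a maximum when \<open>F\<close> is continuous (see \<open>graph_max_attained\<close> below).\<close>

definition graph_max ::
  "(complex ^ ('n::finite) \<Rightarrow> complex ^ ('m::finite)) \<Rightarrow> ('n + 'm) cpoly \<Rightarrow> real \<Rightarrow> real" where
  "graph_max F p r = (SUP z \<in> cball 0 r. cmod (cpoly_eval p (graph_point F z)))"

text \<open>Since \<open>0 powr 0 = 0\<close>, the choice \<open>C = 0\<close> never satisfies the inequality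
  (take \<open>p = 1\<close>).  With the convention \<open>0\<^sup>0 = 1\<close> it could always be replaced by \<open>C = 1\<close>, so this
  does not affect the notion.\<close>

definition admits_bernstein ::
  "(complex ^ ('n::finite) \<Rightarrow> complex ^ ('m::finite)) \<Rightarrow> (nat \<Rightarrow> real) \<Rightarrow> bool" where
  "admits_bernstein F \<mu> \<longleftrightarrow>
     (\<forall>k. 0 \<le> \<mu> k) \<and>
     (\<forall>r>0. \<exists>C\<ge>0. \<forall>p :: ('n + 'm) cpoly.
        graph_max F p (exp 1 * r) \<le> C powr \<mu> (cpoly_degree p) * graph_max F p r)"

text \<open>\<open>\<langle>\<mu>\<^sub>1\<rangle> \<le> \<langle>\<mu>\<^sub>2\<rangle>\<close> and \<open>\<langle>\<mu>\<^sub>1\<rangle> = \<langle>\<mu>\<^sub>2\<rangle>\<close> for the classes of exponents, in terms of representatives.\<close>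

definition exponent_le :: "(nat \<Rightarrow> real) \<Rightarrow> (nat \<Rightarrow> real) \<Rightarrow> bool" where
  "exponent_le \<mu>\<^sub>1 \<mu>\<^sub>2 \<longleftrightarrow> (\<exists>c>0. \<forall>k. \<mu>\<^sub>1 k \<le> c * \<mu>\<^sub>2 k)"

definition exponent_equiv :: "(nat \<Rightarrow> real) \<Rightarrow> (nat \<Rightarrow> real) \<Rightarrow> bool" where
  "exponent_equiv \<mu>\<^sub>1 \<mu>\<^sub>2 \<longleftrightarrow> (\<exists>c>0. \<forall>k. 1 / c * \<mu>\<^sub>1 k \<le> \<mu>\<^sub>2 k \<and> \<mu>\<^sub>2 k \<le> c * \<mu>\<^sub>1 k)"

text \<open>Minimality of the class of \<open>\<mu>\<^sub>o\<close>.  For continuous \<open>F\<close> a minimal class is automatically the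
  least one (\<open>optimal_exponent_least\<close>), and the formulation with the upper limit follows
  (\<open>optimal_exponent_limsup\<close>).\<close>

definition optimal_exponent ::
  "(complex ^ ('n::finite) \<Rightarrow> complex ^ ('m::finite)) \<Rightarrow> (nat \<Rightarrow> real) \<Rightarrow> bool" where
  "optimal_exponent F \<mu>\<^sub>o \<longleftrightarrow>
     admits_bernstein F \<mu>\<^sub>o \<and>
     (\<forall>\<mu>. admits_bernstein F \<mu> \<and> exponent_le \<mu> \<mu>\<^sub>o \<longrightarrow> exponent_equiv \<mu> \<mu>\<^sub>o)"

lemma continuous_on_graph_poly:
  assumes "continuous_on UNIV F"
  shows "continuous_on S (\<lambda>z. cmod (cpoly_eval p (graph_point F z)))"
proof -
  have F: "continuous_on S (\<lambda>z. F z $ b)" for b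
    using continuous_on_subset[OF assms] by (intro continuous_intros) auto
  have v: "continuous_on S (\<lambda>z. graph_point F z $ v)" for v
    by (cases v) (auto simp: graph_point_def intro!: continuous_intros F)
  then show ?thesis
    unfolding cpoly_eval_def
    by (intro continuous_on_norm continuous_on_sum continuous_on_mult continuous_on_prod
        continuous_on_power continuous_on_const v)
qed

lemma graph_max_attained:
  assumes "continuous_on UNIV F" "r \<ge> 0"
  shows "\<exists>z. norm z \<le> r \<and> cmod (cpoly_eval p (graph_point F z)) = graph_max F p r"
    and "norm z \<le> r \<Longrightarrow> cmod (cpoly_eval p (graph_point F z)) \<le> graph_max F p r"
proof -
  let ?g = "\<lambda>z. cmod (cpoly_eval p (graph_point F z))"
  obtain z0 where z0: "z0 \<in> cball 0 r" "\<And>y. y \<in> cball 0 r \<Longrightarrow> ?g y \<le> ?g z0"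
    using continuous_attains_sup[OF compact_cball _ continuous_on_graph_poly[OF assms(1)],
        of 0 r p] assms(2) by auto
  have "graph_max F p r = ?g z0"
    unfolding graph_max_def using z0 by (intro cSup_eq_maximum) auto
  then show "\<exists>z. norm z \<le> r \<and> ?g z = graph_max F p r"
    and "norm z \<le> r \<Longrightarrow> ?g z \<le> graph_max F p r"
    using z0 by auto
qed

lemma graph_max_nonneg:
  assumes "continuous_on UNIV F" "r \<ge> 0"
  shows "0 \<le> graph_max F p r"
  using graph_max_attained(1)[OF assms, of p] norm_ge_zero by metis

lemma admits_bernstein_min:
  assumes F: "continuous_on UNIV F"
    and 1: "admits_bernstein F \<mu>\<^sub>1" and 2: "admits_bernstein F \<mu>\<^sub>2"
  shows "admits_bernstein F (\<lambda>k. min (\<mu>\<^sub>1 k) (\<mu>\<^sub>2 k))"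
  unfolding admits_bernstein_def
proof (intro conjI allI impI)
  fix k show "0 \<le> min (\<mu>\<^sub>1 k) (\<mu>\<^sub>2 k)"
    using 1 2 by (simp add: admits_bernstein_def)
next
  fix r :: real assume r: "r > 0"
  obtain C1 where C1: "C1 \<ge> 0"
    "\<And>p. graph_max F p (exp 1 * r) \<le> C1 powr \<mu>\<^sub>1 (cpoly_degree p) * graph_max F p r"
    using 1 r unfolding admits_bernstein_def by blast
  obtain C2 where C2: "C2 \<ge> 0"
    "\<And>p. graph_max F p (exp 1 * r) \<le> C2 powr \<mu>\<^sub>2 (cpoly_degree p) * graph_max F p r"
    using 2 r unfolding admits_bernstein_def by blast
  let ?C = "max C1 C2"
  have nn: "0 \<le> graph_max F p r" for p
    using graph_max_nonneg[OF F] r by simp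
  have "graph_max F p (exp 1 * r)
      \<le> ?C powr min (\<mu>\<^sub>1 (cpoly_degree p)) (\<mu>\<^sub>2 (cpoly_degree p)) * graph_max F p r" for p
  proof -
    have *: "C powr a * graph_max F p r \<le> ?C powr a * graph_max F p r"
      if "0 \<le> C" "C \<le> ?C" "0 \<le> a" for C a
      using that nn by (intro mult_right_mono powr_mono2) auto
    have "0 \<le> \<mu>\<^sub>1 (cpoly_degree p)" "0 \<le> \<mu>\<^sub>2 (cpoly_degree p)"
      using 1 2 by (auto simp: admits_bernstein_def)
    then show ?thesis
      using C1(2)[of p] C2(2)[of p] *[of C1 "\<mu>\<^sub>1 (cpoly_degree p)"]
        *[of C2 "\<mu>\<^sub>2 (cpoly_degree p)"] C1(1) C2(1)
      by (auto simp: min_def)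
  qed
  then show "\<exists>C\<ge>0. \<forall>p. graph_max F p (exp 1 * r)
      \<le> C powr min (\<mu>\<^sub>1 (cpoly_degree p)) (\<mu>\<^sub>2 (cpoly_degree p)) * graph_max F p r"
    using C1(1) by (intro exI[of _ ?C]) auto
qed

lemma optimal_exponent_least:
  assumes F: "continuous_on UNIV F" and o: "optimal_exponent F \<mu>\<^sub>o" and m: "admits_bernstein F \<mu>"
  shows "exponent_le \<mu>\<^sub>o \<mu>"
proof -
  let ?\<nu> = "\<lambda>k. min (\<mu> k) (\<mu>\<^sub>o k)"
  have "admits_bernstein F ?\<nu>"
    using admits_bernstein_min[OF F m] o by (simp add: optimal_exponent_def)
  moreover have "exponent_le ?\<nu> \<mu>\<^sub>o"
    unfolding exponent_le_def by (intro exI[of _ 1]) auto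
  ultimately have "exponent_equiv ?\<nu> \<mu>\<^sub>o"
    using o unfolding optimal_exponent_def by blast
  then obtain c where c: "c > 0" "\<And>k. \<mu>\<^sub>o k \<le> c * ?\<nu> k"
    unfolding exponent_equiv_def by blast
  have "\<mu>\<^sub>o k \<le> c * \<mu> k" for k
    using c(2)[of k] mult_left_mono[of "?\<nu> k" "\<mu> k" c] c(1) by linarith
  then show ?thesis
    unfolding exponent_le_def using c(1) by blast
qed

lemma optimal_exponent_limsup:
  assumes F: "continuous_on UNIV F" and o: "optimal_exponent F \<mu>\<^sub>o"
    and lim: "limsup (\<lambda>k. ereal (\<mu>\<^sub>o k) / ereal (\<mu> k)) = \<infinity>"
  shows "\<not> admits_bernstein F \<mu>"
proof
  assume m: "admits_bernstein F \<mu>"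
  obtain c where c: "c > 0" "\<And>k. \<mu>\<^sub>o k \<le> c * \<mu> k"
    using optimal_exponent_least[OF F o m] unfolding exponent_le_def by blast
  have "0 \<le> \<mu> k" "0 \<le> \<mu>\<^sub>o k" for k
    using m o by (auto simp: optimal_exponent_def admits_bernstein_def)
  then have "ereal (\<mu>\<^sub>o k) / ereal (\<mu> k) \<le> ereal c" for k
    using c(2)[of k] c(1)
    by (cases "\<mu> k = 0") (auto simp: divide_le_eq order_less_le intro: antisym)
  then have "limsup (\<lambda>k. ereal (\<mu>\<^sub>o k) / ereal (\<mu> k)) \<le> ereal c"
    by (intro Limsup_bounded) auto
  with lim show False by simp
qed

end

theory Submission
  imports Defs "HOL-Complex_Analysis.Conformal_Mappings"
begin

text \<open>The automorphisms only change degrees by bounded factors, so everything reduces to functions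
  \<open>p (w, e\<^bsup>\<alpha> w\<^esup>)\<close>. In a single variable these are exponential polynomials annihilated by a product
  of \<open>n \<le> (K + 1)\<^bsup>m + 1\<^esup>\<close> operators \<open>D - b\<close> with \<open>\<bar>b\<bar> = O(K)\<close>, where \<open>K\<close> bounds the degree.
  Solving the factors one after another bounds such a function on a large disc by \<open>C\<^bsup>n + K\<^esup>\<close> times
  its maximum on a small one; applying this in each variable gives the Bernstein type inequality.

  Conversely, for \<open>\<rat>\<close>-independent \<open>\<alpha>\<close> the frequencies are distinct, and solving \<open>g' - b g = h\<close>
  once for each operator yields a nonzero function of the same kind vanishing to order \<open>n - 1\<close> at
  a given point. By the maximum principle it grows by a factor \<open>e\<^bsup>n - 1\<^esup>\<close> from radius \<open>r\<close> to \<open>e r\<close>.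
  As exponents need not be monotone, a power of a coordinate is multiplied on to reach degree
  exactly \<open>k\<close>, which only increases the order of vanishing.\<close>

section \<open>Polynomial functions with a degree bound\<close>

text \<open>Only an upper bound on the degree is recorded, so cancellation in sums and compositions
  needs no discussion, and substitutions can be checked on values alone.\<close>

definition poly_fun :: "nat \<Rightarrow> (complex ^ ('v::finite) \<Rightarrow> complex) \<Rightarrow> bool" where
  "poly_fun d g \<longleftrightarrow> (\<exists>p. cpoly_degree p \<le> d \<and> (\<forall>x. cpoly_eval p x = g x))"

lemma cpoly_degree_le_iff:
  "cpoly_degree p \<le> d \<longleftrightarrow>
     (\<forall>a\<in>Poly_Mapping.keys p. (\<Sum>v\<in>UNIV. Poly_Mapping.lookup a v) \<le> d)"
  unfolding cpoly_degree_def by (subst Max_le_iff) auto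

lemma cpoly_eval_superset:
  assumes "finite S" "Poly_Mapping.keys p \<subseteq> S"
  shows "cpoly_eval p x =
    (\<Sum>a\<in>S. Poly_Mapping.lookup p a * (\<Prod>v\<in>UNIV. (x $ v) ^ Poly_Mapping.lookup a v))"
  unfolding cpoly_eval_def
  by (rule sum.mono_neutral_left) (use assms in \<open>auto simp: in_keys_iff\<close>)

lemma cpoly_eval_add: "cpoly_eval (p + q) x = cpoly_eval p x + cpoly_eval q x"
proof -
  let ?S = "Poly_Mapping.keys p \<union> Poly_Mapping.keys q"
  have "Poly_Mapping.keys (p + q) \<subseteq> ?S"
    by (rule Poly_Mapping.keys_add)
  then show ?thesis
    by (simp add: cpoly_eval_superset[where S = ?S] lookup_add distrib_right sum.distrib)
qed

lemma cpoly_eval_zero [simp]: "cpoly_eval 0 x = 0"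
  by (simp add: cpoly_eval_def)

lemma cpoly_eval_sum: "cpoly_eval (sum p A) x = (\<Sum>i\<in>A. cpoly_eval (p i) x)"
  by (induction A rule: infinite_finite_induct) (auto simp: cpoly_eval_add)

lemma cpoly_eval_single:
  "cpoly_eval (Poly_Mapping.single a c) x = c * (\<Prod>v\<in>UNIV. (x $ v) ^ Poly_Mapping.lookup a v)"
  by (cases "c = 0") (auto simp: cpoly_eval_def)

lemma poly_fun_mono: "poly_fun d g \<Longrightarrow> d \<le> d' \<Longrightarrow> poly_fun d' g"
  unfolding poly_fun_def by (meson le_trans)

lemma poly_fun_monomial:
  assumes "(\<Sum>v\<in>UNIV. e v) \<le> d"
  shows "poly_fun d (\<lambda>x :: complex ^ ('v::finite). c * (\<Prod>v\<in>UNIV. (x $ v) ^ e v))"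
proof -
  have e: "Poly_Mapping.lookup (Abs_poly_mapping e) = e"
    by (rule Abs_poly_mapping_inverse) simp
  show ?thesis
    unfolding poly_fun_def
    by (rule exI[of _ "Poly_Mapping.single (Abs_poly_mapping e) c"])
      (use assms in \<open>auto simp: cpoly_degree_le_iff cpoly_eval_single e\<close>)
qed

lemma poly_fun_const: "poly_fun d (\<lambda>x. c)"
  using poly_fun_monomial[of "\<lambda>_. 0" d c] by simp

lemma poly_fun_coord: "poly_fun 1 (\<lambda>x. x $ v)"
proof -
  have "(\<Prod>u\<in>UNIV. (x $ u) ^ (if u = v then 1 else 0)) = x $ v" for x :: "complex ^ 'a"
    by (subst prod.remove[of _ v]) auto
  then show ?thesis
    using poly_fun_monomial[of "\<lambda>u. if u = v then 1 else 0" 1 1] by simp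
qed

lemma poly_fun_add:
  assumes "poly_fun d g" "poly_fun d h"
  shows "poly_fun d (\<lambda>x. g x + h x)"
proof -
  obtain p q where "cpoly_degree p \<le> d" "\<forall>x. cpoly_eval p x = g x"
    "cpoly_degree q \<le> d" "\<forall>x. cpoly_eval q x = h x"
    using assms unfolding poly_fun_def by blast
  then show ?thesis
    unfolding poly_fun_def
    using Poly_Mapping.keys_add[of p q]
    by (intro exI[of _ "p + q"]) (auto simp: cpoly_degree_le_iff cpoly_eval_add)
qed

lemma poly_fun_sum:
  assumes "\<And>i. i \<in> A \<Longrightarrow> poly_fun d (g i)"
  shows "poly_fun d (\<lambda>x. \<Sum>i\<in>A. g i x)"
  using assms
proof (induction A rule: infinite_finite_induct)
  case (insert i A)
  then have "poly_fun d (\<lambda>x. g i x + (\<Sum>i\<in>A. g i x))"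
    by (intro poly_fun_add) auto
  with insert show ?case by simp
qed (simp_all add: poly_fun_const)

lemma poly_fun_mult:
  assumes "poly_fun d g" "poly_fun e h"
  shows "poly_fun (d + e) (\<lambda>x. g x * h x)"
proof -
  obtain p q where p: "cpoly_degree p \<le> d" "\<And>x. cpoly_eval p x = g x"
    and q: "cpoly_degree q \<le> e" "\<And>x. cpoly_eval q x = h x"
    using assms unfolding poly_fun_def by blast
  let ?l = "Poly_Mapping.lookup"
  have "poly_fun (d + e) (\<lambda>x. \<Sum>a\<in>Poly_Mapping.keys p. \<Sum>b\<in>Poly_Mapping.keys q.
      (?l p a * ?l q b) * (\<Prod>v\<in>UNIV. (x $ v) ^ (?l a v + ?l b v)))"
  proof (intro poly_fun_sum poly_fun_monomial)
    fix a b assume "a \<in> Poly_Mapping.keys p" "b \<in> Poly_Mapping.keys q"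
    then show "(\<Sum>v\<in>UNIV. ?l a v + ?l b v) \<le> d + e"
      using p(1) q(1) unfolding cpoly_degree_le_iff sum.distrib by (meson add_mono)
  qed
  moreover have "(\<Sum>a\<in>Poly_Mapping.keys p. \<Sum>b\<in>Poly_Mapping.keys q.
      (?l p a * ?l q b) * (\<Prod>v\<in>UNIV. (x $ v) ^ (?l a v + ?l b v))) = g x * h x" for x
    unfolding p(2)[symmetric] q(2)[symmetric] cpoly_eval_def sum_product
    by (intro sum.cong refl) (simp add: power_add prod.distrib)
  ultimately show ?thesis
    by simp
qed

lemma poly_fun_power:
  assumes "poly_fun d g"
  shows "poly_fun (n * d) (\<lambda>x. g x ^ n)"
proof (induction n)
  case (Suc n)
  from poly_fun_mult[OF assms this] show ?case by simp
qed (simp add: poly_fun_const)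

lemma poly_fun_prod:
  assumes "\<And>i. i \<in> A \<Longrightarrow> poly_fun (d i) (g i)"
  shows "poly_fun (\<Sum>i\<in>A. d i) (\<lambda>x. \<Prod>i\<in>A. g i x)"
  using assms
proof (induction A rule: infinite_finite_induct)
  case (insert i A)
  then have "poly_fun (d i + (\<Sum>i\<in>A. d i)) (\<lambda>x. g i x * (\<Prod>i\<in>A. g i x))"
    by (intro poly_fun_mult) auto
  with insert show ?case by simp
qed (simp_all add: poly_fun_const)

lemma poly_fun_comp:
  assumes "poly_fun d g" "\<And>i. poly_fun D (\<lambda>x. H x $ i)"
  shows "poly_fun (d * D) (\<lambda>x. g (H x))"
proof -
  obtain p where p: "cpoly_degree p \<le> d" "\<And>x. cpoly_eval p x = g x"
    using assms(1) unfolding poly_fun_def by blast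
  let ?l = "Poly_Mapping.lookup"
  have "poly_fun (0 + (\<Sum>v\<in>UNIV. ?l a v * D)) (\<lambda>x. ?l p a * (\<Prod>v\<in>UNIV. (H x $ v) ^ ?l a v))" for a
    by (rule poly_fun_mult[OF poly_fun_const poly_fun_prod[OF poly_fun_power[OF assms(2)]]])
  moreover have "0 + (\<Sum>v\<in>UNIV. ?l a v * D) \<le> d * D" if "a \<in> Poly_Mapping.keys p" for a
    using p(1) that unfolding cpoly_degree_le_iff by (simp add: sum_distrib_right[symmetric])
  ultimately have "poly_fun (d * D) (\<lambda>x. cpoly_eval p (H x))"
    unfolding cpoly_eval_def by (rule poly_fun_sum[OF poly_fun_mono])
  then show ?thesis
    by (simp add: p(2))
qed

lemma poly_fun_embed:
  assumes "poly_fun d g"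
  shows "poly_fun d (\<lambda>x :: complex ^ ('v::finite). g (\<chi> i. x $ h i))"
proof -
  have "poly_fun 1 (\<lambda>x :: complex ^ 'v. (\<chi> i. x $ h i) $ i)" for i
    unfolding vec_lambda_beta by (rule poly_fun_coord)
  from poly_fun_comp[OF assms this] show ?thesis by simp
qed

lemma poly_fun_poly:
  assumes "degree p \<le> d"
  shows "poly_fun d (\<lambda>x. poly p (x $ v))"
proof -
  have "poly_fun d (\<lambda>x. \<Sum>i\<le>degree p. coeff p i * (x $ v) ^ i)"
  proof (rule poly_fun_sum)
    fix i assume "i \<in> {..degree p}"
    then show "poly_fun d (\<lambda>x. coeff p i * (x $ v) ^ i)"
      using poly_fun_mono[OF poly_fun_mult[OF poly_fun_const[of 0 "coeff p i"]
            poly_fun_power[OF poly_fun_coord, of i v]], of d] assms by simp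
  qed
  then show ?thesis by (simp add: poly_altdef)
qed

lemma polynomial_map_imp_poly_fun:
  assumes "polynomial_map G"
  shows "\<exists>D. \<forall>i. poly_fun D (\<lambda>x. G x $ i)"
proof -
  obtain p where p: "\<And>x i. G x $ i = cpoly_eval (p i) x"
    using assms unfolding polynomial_map_def by blast
  have "poly_fun (Max (range (\<lambda>i. cpoly_degree (p i)))) (\<lambda>x. G x $ i)" for i
    unfolding poly_fun_def by (intro exI[of _ "p i"]) (auto simp: p)
  then show ?thesis by blast
qed

lemma continuous_on_poly_fun:
  assumes "poly_fun d g"
  shows "continuous_on S g"
proof -
  obtain p where p: "cpoly_eval p = g"
    using assms unfolding poly_fun_def by blast
  have "continuous_on S (cpoly_eval p)"
    unfolding cpoly_eval_def by (intro continuous_intros)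
  then show ?thesis by (simp add: p)
qed

lemma continuous_on_polynomial_map:
  assumes "polynomial_map G"
  shows "continuous_on S G"
proof -
  obtain D where D: "\<And>i. poly_fun D (\<lambda>x. G x $ i)"
    using polynomial_map_imp_poly_fun[OF assms] by blast
  have "continuous_on S (\<lambda>x. \<chi> i. G x $ i)"
    by (intro continuous_intros continuous_on_poly_fun[OF D])
  then show ?thesis by simp
qed

lemma holomorphic_poly_fun:
  assumes "poly_fun d g" "\<And>v. (\<lambda>u. x u $ v) holomorphic_on S"
  shows "(\<lambda>u. g (x u)) holomorphic_on S"
proof -
  obtain p where p: "cpoly_eval p = g"
    using assms unfolding poly_fun_def by blast
  have "(\<lambda>u. cpoly_eval p (x u)) holomorphic_on S"
    unfolding cpoly_eval_def by (intro holomorphic_intros assms)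
  then show ?thesis by (simp add: p)
qed

text \<open>Here the exact degree matters, since an exponent \<mu> need not be monotone. Adding
  \<open>\<tau>\<close> to every exponent vector is injective, so no coefficients cancel and the
  degree rises by exactly \<open>t\<close>.\<close>

lemma cpoly_shift_degree:
  fixes p :: "('v::finite) cpoly"
  assumes "p \<noteq> 0"
  shows "\<exists>q. cpoly_degree q = cpoly_degree p + t \<and> (\<forall>x. cpoly_eval q x = (x $ v) ^ t * cpoly_eval p x)"
proof -
  let ?l = "Poly_Mapping.lookup" and ?K = "Poly_Mapping.keys p"
  define \<tau> :: "'v \<Rightarrow>\<^sub>0 nat" where "\<tau> = Poly_Mapping.single v t"
  define q where "q = (\<Sum>a\<in>?K. Poly_Mapping.single (a + \<tau>) (?l p a))"
  have lq: "?l q b = (\<Sum>a\<in>?K. if a + \<tau> = b then ?l p a else 0)" for b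
    unfolding q_def lookup_sum by (simp add: lookup_single when_def)
  have l1: "?l q (a + \<tau>) = ?l p a" if "a \<in> ?K" for a
    using that unfolding lq by (simp add: sum.delta')
  have keys: "Poly_Mapping.keys q = (\<lambda>a. a + \<tau>) ` ?K"
  proof
    show "(\<lambda>a. a + \<tau>) ` ?K \<subseteq> Poly_Mapping.keys q"
      using l1 by (auto simp: in_keys_iff)
    show "Poly_Mapping.keys q \<subseteq> (\<lambda>a. a + \<tau>) ` ?K"
    proof
      fix b assume "b \<in> Poly_Mapping.keys q"
      then have "(\<Sum>a\<in>?K. if a + \<tau> = b then ?l p a else 0) \<noteq> 0"
        by (simp add: in_keys_iff lq)
      then obtain a where "a \<in> ?K" "(if a + \<tau> = b then ?l p a else 0) \<noteq> 0"
        by (rule sum.not_neutral_contains_not_neutral)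
      then show "b \<in> (\<lambda>a. a + \<tau>) ` ?K"
        by (auto split: if_splits)
    qed
  qed
  have \<tau>: "(\<Sum>u\<in>UNIV. ?l \<tau> u) = t" "(\<Prod>u\<in>UNIV. (x $ u) ^ ?l \<tau> u) = (x $ v) ^ t" for x :: "complex ^ 'v"
    by (auto simp: \<tau>_def lookup_single when_def if_distrib[of "\<lambda>n. _ ^ n"] cong: if_cong)
  have deg: "cpoly_degree r \<in> (\<lambda>a. \<Sum>v\<in>UNIV. ?l a v) ` Poly_Mapping.keys r"
    if "r \<noteq> 0" for r :: "'v cpoly"
  proof -
    have "Poly_Mapping.keys r \<noteq> {}"
      using that by simp
    then have "cpoly_degree r = Max ((\<lambda>a. \<Sum>v\<in>UNIV. ?l a v) ` Poly_Mapping.keys r)"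
      unfolding cpoly_degree_def by (subst Max_insert) auto
    also have "\<dots> \<in> (\<lambda>a. \<Sum>v\<in>UNIV. ?l a v) ` Poly_Mapping.keys r"
      using that by (intro Max_in) auto
    finally show ?thesis .
  qed
  obtain a where a: "a \<in> ?K" "cpoly_degree p = (\<Sum>v\<in>UNIV. ?l a v)"
    using deg[OF assms] by blast
  have s: "(\<Sum>u\<in>UNIV. ?l (b + \<tau>) u) = (\<Sum>u\<in>UNIV. ?l b u) + t" for b
    by (simp add: lookup_add sum.distrib \<tau>(1))
  have "cpoly_degree q \<le> cpoly_degree p + t"
    unfolding cpoly_degree_le_iff keys using cpoly_degree_le_iff[of p "cpoly_degree p"] by (auto simp: s)
  moreover have "cpoly_degree q \<ge> cpoly_degree p + t"
    using cpoly_degree_le_iff[of q "cpoly_degree q"] a s by (auto simp: keys)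
  moreover have "cpoly_eval q x = (x $ v) ^ t * cpoly_eval p x" for x
    unfolding q_def cpoly_eval_sum cpoly_eval_single
    by (simp add: lookup_add power_add prod.distrib \<tau>(2) cpoly_eval_def sum_distrib_left mult_ac)
  ultimately show ?thesis
    by (intro exI[of _ q]) auto
qed

section \<open>Automorphisms acting on the two blocks of graph coordinates\<close>

definition block_map ::
  "(complex ^ ('n::finite) \<Rightarrow> complex ^ 'n) \<Rightarrow> (complex ^ ('k::finite) \<Rightarrow> complex ^ 'k) \<Rightarrow>
    complex ^ ('n + 'k) \<Rightarrow> complex ^ ('n + 'k)" where
  "block_map A B x = (\<chi> i. case i of
      Inl a \<Rightarrow> A (\<chi> a. x $ Inl a) $ a | Inr b \<Rightarrow> B (\<chi> b. x $ Inr b) $ b)"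

lemma block_map_graph_point:
  "block_map A B (graph_point F z) = (\<chi> i. case i of Inl a \<Rightarrow> A z $ a | Inr b \<Rightarrow> B (F z) $ b)"
  unfolding block_map_def graph_point_def by (simp add: vec_eq_iff)

text \<open>\<open>block_map (inv P) Q\<close> carries the graph of the exponential map to that of
  the composed map, and \<open>block_map P (inv Q)\<close> goes back. The factor \<open>D\<close> is
  uniform in the polynomial, so either passage costs only a bounded multiple of the degree.\<close>

lemma poly_fun_block_map:
  assumes "polynomial_map A" "polynomial_map B"
  shows "\<exists>D\<ge>1. \<forall>d g. poly_fun d g \<longrightarrow> poly_fun (d * D) (\<lambda>x. g (block_map A B x))"
proof -
  obtain a b where a: "\<And>i. poly_fun a (\<lambda>x. A x $ i)" and b: "\<And>i. poly_fun b (\<lambda>x. B x $ i)"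
    using polynomial_map_imp_poly_fun[OF assms(1)] polynomial_map_imp_poly_fun[OF assms(2)] by blast
  have "poly_fun (a + b + 1) (\<lambda>x. block_map A B x $ i)" for i
  proof (cases i)
    case (Inl v)
    have "poly_fun (a + b + 1) (\<lambda>x. A (\<chi> i. x $ Inl i) $ v)"
      by (rule poly_fun_mono[OF poly_fun_embed[OF a]]) simp
    then show ?thesis by (simp add: block_map_def Inl)
  next
    case (Inr v)
    have "poly_fun (a + b + 1) (\<lambda>x. B (\<chi> i. x $ Inr i) $ v)"
      by (rule poly_fun_mono[OF poly_fun_embed[OF b]]) simp
    then show ?thesis by (simp add: block_map_def Inr)
  qed
  then show ?thesis
    by (intro exI[of _ "a + b + 1"]) (auto intro!: poly_fun_comp simp del: add_Suc_right)
qed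

section \<open>Products of first order differential operators\<close>

text \<open>The head of the list acts first. Keeping the factors D - b in a list, with repetitions
  as multiplicities, allows them to be solved one at a time.\<close>

fun lin_diff_op :: "complex list \<Rightarrow> (complex \<Rightarrow> complex) \<Rightarrow> complex \<Rightarrow> complex" where
  "lin_diff_op [] g = g"
| "lin_diff_op (b # bs) g = lin_diff_op bs (\<lambda>z. deriv g z - b * g z)"

lemma lin_diff_op_snoc:
  "lin_diff_op (bs @ [b]) g = (\<lambda>z. deriv (lin_diff_op bs g) z - b * lin_diff_op bs g z)"
  by (induction bs arbitrary: g) auto

lemma holomorphic_lin_diff_op:
  "g holomorphic_on UNIV \<Longrightarrow> lin_diff_op bs g holomorphic_on UNIV"
proof (induction bs arbitrary: g)
  case (Cons b bs)
  show ?case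
    unfolding lin_diff_op.simps by (intro Cons.IH holomorphic_intros Cons.prems open_UNIV)
qed simp

lemma lin_diff_op_zero: "lin_diff_op bs (\<lambda>_. 0) = (\<lambda>_. 0)"
  by (induction bs) auto

lemma entire_deriv: "g holomorphic_on UNIV \<Longrightarrow> (g has_field_derivative deriv g z) (at z)"
  using holomorphic_derivI[of g UNIV z] by simp

lemma lin_diff_op_sum:
  assumes "\<And>i. i \<in> I \<Longrightarrow> g i holomorphic_on UNIV"
  shows "lin_diff_op bs (\<lambda>z. \<Sum>i\<in>I. g i z) = (\<lambda>z. \<Sum>i\<in>I. lin_diff_op bs (g i) z)"
  using assms
proof (induction bs arbitrary: g)
  case (Cons b bs)
  have d: "deriv (\<lambda>z. \<Sum>i\<in>I. g i z) z = (\<Sum>i\<in>I. deriv (g i) z)" for z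
    by (intro DERIV_imp_deriv DERIV_sum entire_deriv Cons.prems)
  have "lin_diff_op (b # bs) (\<lambda>z. \<Sum>i\<in>I. g i z)
      = lin_diff_op bs (\<lambda>z. \<Sum>i\<in>I. deriv (g i) z - b * g i z)"
    by (simp add: d sum_subtractf sum_distrib_left)
  also have "\<dots> = (\<lambda>z. \<Sum>i\<in>I. lin_diff_op bs (\<lambda>z. deriv (g i) z - b * g i z) z)"
    by (intro Cons.IH holomorphic_intros Cons.prems open_UNIV)
  finally show ?case by simp
qed simp

lemma DERIV_poly_exp:
  "((\<lambda>z. poly p z * exp (\<gamma> * z)) has_field_derivative poly (pderiv p + smult \<gamma> p) z * exp (\<gamma> * z)) (at z)"
  for \<gamma> :: complex
  by (auto intro!: derivative_eq_intros simp: algebra_simps)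

text \<open>A factor with \<open>b = \<gamma>\<close> lowers the degree of the polynomial
  coefficient, or kills it if it is constant; any other factor does not raise the degree.\<close>

lemma lin_diff_op_poly_exp:
  assumes "p = 0 \<or> degree p < count_list bs \<gamma>"
  shows "lin_diff_op bs (\<lambda>z. poly p z * exp (\<gamma> * z)) = (\<lambda>_. 0)"
  using assms
proof (induction bs arbitrary: p)
  case (Cons b bs)
  show ?case
  proof (cases "p = 0")
    case False
    let ?q = "pderiv p + smult (\<gamma> - b) p"
    have "deriv (\<lambda>z. poly p z * exp (\<gamma> * z)) z - b * (poly p z * exp (\<gamma> * z))
        = poly ?q z * exp (\<gamma> * z)" for z
      by (subst DERIV_imp_deriv[OF DERIV_poly_exp]) (simp add: algebra_simps)
    moreover have "?q = 0 \<or> degree ?q < count_list bs \<gamma>"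
    proof (cases "b = \<gamma>")
      case True
      then have "degree p < Suc (count_list bs \<gamma>)"
        using Cons.prems False by simp
      with True show ?thesis
        by (cases "degree p = 0") (auto simp: degree_pderiv pderiv_eq_0_iff)
    next
      case nb: False
      have "degree ?q \<le> degree p"
        by (rule degree_add_le) (auto simp: degree_pderiv)
      then show ?thesis
        using Cons.prems False nb by auto
    qed
    ultimately show ?thesis
      using Cons.IH[of ?q] by simp
  qed (simp add: lin_diff_op_zero)
qed simp

text \<open>Variation of constants along the segment from \<open>c\<close> to \<open>c + z\<close>
  recovers \<open>g\<close> from \<open>G = g' - b g\<close>. The exponential factors on the two
  parts of the segment multiply to a single \<open>exp (\<Delta> * cmod z)\<close>, so they do not
  accumulate with the number of operators.\<close>

lemma lin_diff_op_growth:
  assumes "g holomorphic_on UNIV" "lin_diff_op bs g = (\<lambda>_. 0)" "\<And>b. b \<in> set bs \<Longrightarrow> cmod b \<le> \<Delta>"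
  shows "cmod (g (c + z)) \<le> exp (\<Delta> * cmod z) *
    (\<Sum>k<length bs. cmod (lin_diff_op (take k bs) g c) * cmod z ^ k / fact k)"
  using assms
proof (induction bs arbitrary: g z)
  case Nil
  then have "g = (\<lambda>_. 0)" by simp
  then show ?case by simp
next
  case (Cons b bs)
  define G where "G = (\<lambda>z. deriv g z - b * g z)"
  define a where "a = (\<lambda>k. cmod (lin_diff_op (take k bs) G c))"
  define n where "n = length bs"
  define T where "T = cmod z"
  \<comment> \<open>The integrating factor is normalised so that \<open>h 1 = g (c + z)\<close>; the
    term containing \<open>g\<close> cancels in \<open>h'\<close>, leaving only
    \<open>G\<close>.\<close>
  define h where "h = (\<lambda>t::real. exp (b * (1 - of_real t) * z) * g (c + of_real t * z))"
  define h' where "h' = (\<lambda>t::real. z * exp (b * (1 - of_real t) * z) * G (c + of_real t * z))"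
  \<comment> \<open>A majorant with \<open>\<phi> 0 = 0\<close>: its derivative
    \<open>\<phi>'\<close> is the bound on \<open>h'\<close> that the induction hypothesis at
    \<open>t * z\<close> provides.\<close>
  define \<phi> where "\<phi> = (\<lambda>t. exp (\<Delta> * T) * (\<Sum>k<n. a k * T ^ Suc k * t ^ Suc k / fact (Suc k)))"
  define \<phi>' where "\<phi>' = (\<lambda>t. exp (\<Delta> * T) * (\<Sum>k<n. a k * T ^ Suc k * t ^ k / fact k))"
  have hol: "G holomorphic_on UNIV"
    unfolding G_def by (intro holomorphic_intros Cons.prems open_UNIV)
  have T0: "T \<ge> 0" by (simp add: T_def)
  have bd: "cmod b \<le> \<Delta>" using Cons.prems by simp
  have IH: "cmod (G (c + y)) \<le> exp (\<Delta> * cmod y) * (\<Sum>k<n. a k * cmod y ^ k / fact k)" for y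
    using Cons.IH[OF hol, of y] Cons.prems unfolding G_def a_def n_def by simp
  have ex: "cmod (exp (b * (1 - of_real t) * z)) \<le> exp (\<Delta> * ((1 - t) * T))" if "t \<le> 1" for t :: real
  proof -
    have "cmod (exp (b * (1 - of_real t) * z)) \<le> exp (cmod (b * (1 - of_real t) * z))"
      by (rule norm_exp)
    also have "cmod (b * (1 - of_real t) * z) = cmod b * ((1 - t) * T)"
      using that norm_of_real[of "1 - t", where 'a = complex] by (simp add: norm_mult T_def)
    also have "\<dots> \<le> \<Delta> * ((1 - t) * T)"
      using bd that T0 by (intro mult_right_mono) auto
    finally show ?thesis by simp
  qed
  have dh: "(h has_vector_derivative h' t) (at t)" for t
  proof -
    let ?t = "of_real t :: complex"
    have "((\<lambda>u. c + u * z) has_field_derivative z) (at ?t)"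
      by (auto intro!: derivative_eq_intros)
    from DERIV_chain2[OF entire_deriv[OF Cons.prems(1)] this]
    have 1: "((\<lambda>u. g (c + u * z)) has_field_derivative deriv g (c + ?t * z) * z) (at ?t)" .
    have 2: "((\<lambda>u. exp (b * (1 - u) * z)) has_field_derivative - (b * z) * exp (b * (1 - ?t) * z)) (at ?t)"
      by (auto intro!: derivative_eq_intros simp: algebra_simps)
    have "((\<lambda>u. exp (b * (1 - u) * z) * g (c + u * z)) has_field_derivative h' t) (at ?t)"
      using DERIV_mult[OF 2 1] unfolding h'_def G_def by (simp add: algebra_simps)
    from has_vector_derivative_real_field[OF this] show ?thesis
      unfolding h_def by simp
  qed
  have d\<phi>: "(\<phi> has_vector_derivative \<phi>' t) (at t)" for t
  proof -
    have "((\<lambda>t. a k * T ^ Suc k * t ^ Suc k / fact (Suc k)) has_field_derivative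
        a k * T ^ Suc k * t ^ k / fact k) (at t)" for k
      by (rule derivative_eq_intros refl | simp)+
    then have "(\<phi> has_field_derivative \<phi>' t) (at t)"
      unfolding \<phi>_def \<phi>'_def by (intro DERIV_cmult DERIV_sum)
    then show ?thesis
      by (simp add: has_real_derivative_iff_has_vector_derivative)
  qed
  have le: "norm (h' t) \<le> \<phi>' t" if "0 < t" "t < 1" for t
  proof -
    have "norm (h' t) = T * cmod (exp (b * (1 - of_real t) * z)) * cmod (G (c + of_real t * z))"
      unfolding h'_def by (simp add: norm_mult T_def)
    also have "\<dots> \<le> T * exp (\<Delta> * ((1 - t) * T)) *
        (exp (\<Delta> * (t * T)) * (\<Sum>k<n. a k * (t * T) ^ k / fact k))"
      using IH[of "of_real t * z"] ex[of t] that T0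
      by (intro mult_mono mult_left_mono) (auto simp: norm_mult T_def)
    also have "\<dots> = (exp (\<Delta> * ((1 - t) * T)) * exp (\<Delta> * (t * T))) * (\<Sum>k<n. T * (a k * (t * T) ^ k / fact k))"
      by (simp add: mult_ac sum_distrib_left)
    also have "exp (\<Delta> * ((1 - t) * T)) * exp (\<Delta> * (t * T)) = exp (\<Delta> * T)"
      by (simp add: exp_add[symmetric] algebra_simps)
    finally show ?thesis
      unfolding \<phi>'_def by (simp add: power_mult_distrib mult_ac)
  qed
  have "norm (h 1 - h 0) \<le> \<phi> 1 - \<phi> 0"
  proof (rule differentiable_bound_general)
    show "continuous_on {0..1} h" "continuous_on {0..1} \<phi>"
      using dh d\<phi> by (auto intro!: continuous_at_imp_continuous_on has_vector_derivative_continuous)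
  qed (use dh d\<phi> le in auto)
  moreover have "h 1 = g (c + z)" "\<phi> 0 = 0"
    by (auto simp: h_def \<phi>_def)
  moreover have "norm (h 0) \<le> exp (\<Delta> * T) * cmod (g c)"
    using ex[of 0] by (auto simp: h_def norm_mult mult_right_mono)
  ultimately have "cmod (g (c + z)) \<le> exp (\<Delta> * T) * (cmod (g c) + (\<Sum>k<n. a k * T ^ Suc k / fact (Suc k)))"
    using norm_triangle_ineq2[of "h 1" "h 0"] unfolding \<phi>_def by (simp add: distrib_left)
  also have "cmod (g c) + (\<Sum>k<n. a k * T ^ Suc k / fact (Suc k)) =
     (\<Sum>k<length (b # bs). cmod (lin_diff_op (take k (b # bs)) g c) * T ^ k / fact k)"
    unfolding list.size add_0_right Nat.add_Suc_right sum.lessThan_Suc_shift a_def n_def G_def by simp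
  finally show ?case
    by (simp add: T_def)
qed

text \<open>Cauchy estimates start the induction. An appended factor D - b needs one more
  derivative, so all orders \<open>j\<close> are treated together. The binomial coefficient is at
  most \<open>2 ^ (X + length bs)\<close>, which keeps the total cost exponential.\<close>

lemma deriv_lin_diff_op_bound:
  assumes "g holomorphic_on UNIV" "\<And>z. z \<in> cball c s \<Longrightarrow> cmod (g z) \<le> M" "s > 0"
    and "\<And>b. b \<in> set bs \<Longrightarrow> cmod b \<le> \<Delta>" "\<Delta> * s \<le> real X"
  shows "cmod ((deriv ^^ j) (lin_diff_op bs g) c) \<le>
    M * fact (j + length bs) / s ^ (j + length bs) * real ((X + length bs) choose length bs)"
  using assms(4)
proof (induction bs arbitrary: j rule: rev_induct)
  case Nil
  have "cmod ((deriv ^^ j) g c) \<le> fact j * M / s ^ j"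
    using assms by (intro Cauchy_inequality) (auto intro!: holomorphic_on_imp_continuous_on
        elim: holomorphic_on_subset simp: dist_norm norm_minus_commute)
  then show ?case by (simp add: mult.commute)
next
  case (snoc b bs)
  define L where "L = lin_diff_op bs g"
  define n where "n = length bs"
  define B where "B = real ((X + n) choose n)"
  have hol: "L holomorphic_on UNIV"
    unfolding L_def by (rule holomorphic_lin_diff_op[OF assms(1)])
  have M0: "M \<ge> 0"
    using assms(2)[of c] assms(3) norm_ge_zero[of "g c"] by (simp del: norm_ge_zero)
  have IH: "cmod ((deriv ^^ j) L c) \<le> M * fact (j + n) / s ^ (j + n) * B" for j
    using snoc unfolding L_def n_def B_def by simp
  have "(deriv ^^ j) (\<lambda>z. deriv L z - b * L z) c = (deriv ^^ j) (deriv L) c - (deriv ^^ j) (\<lambda>z. b * L z) c"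
    by (rule higher_deriv_diff[of _ UNIV]) (auto intro!: holomorphic_intros hol)
  also have "(deriv ^^ j) (\<lambda>z. b * L z) c = b * (deriv ^^ j) L c"
    by (rule higher_deriv_cmult[of _ UNIV]) (use hol in auto)
  also have "(deriv ^^ j) (deriv L) = (deriv ^^ Suc j) L"
    by (simp add: funpow_swap1)
  finally have eq: "(deriv ^^ j) (lin_diff_op (bs @ [b]) g) c = (deriv ^^ Suc j) L c - b * (deriv ^^ j) L c"
    unfolding lin_diff_op_snoc L_def .
  have "cmod ((deriv ^^ j) (lin_diff_op (bs @ [b]) g) c) \<le>
      cmod ((deriv ^^ Suc j) L c) + cmod b * cmod ((deriv ^^ j) L c)"
    unfolding eq norm_mult[symmetric] by (rule norm_triangle_ineq4)
  also have "\<dots> \<le> M * fact (Suc j + n) / s ^ (Suc j + n) * B + \<Delta> * (M * fact (j + n) / s ^ (j + n) * B)"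
    using snoc.prems norm_ge_zero[of b]
    by (intro add_mono mult_mono IH) (auto intro: order_trans[OF norm_ge_zero])
  also have "\<dots> = M * fact (j + n) / s ^ (Suc j + n) * B * (real (Suc j + n) + \<Delta> * s)"
    using assms(3) by (simp add: field_simps)
  \<comment> \<open>Since \<open>n + 1\<close> is at most \<open>Suc j + n\<close>, the summand
    \<open>\<Delta> * s \<le> X\<close> costs at most the factor
    \<open>(X + n + 1) / (n + 1)\<close>, the ratio of consecutive binomial coefficients.\<close>
  also have "\<dots> \<le> M * fact (j + n) / s ^ (Suc j + n) * B * (real (Suc j + n) * ((real X + real n + 1) / (real n + 1)))"
  proof (intro mult_left_mono)
    have "real X * (real n + 1) \<le> real X * real (Suc j + n)"
      by (intro mult_left_mono) auto
    then have "real X \<le> real (Suc j + n) * (real X / (real n + 1))"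
      by (simp add: field_simps)
    moreover have "real (Suc j + n) * ((real X + real n + 1) / (real n + 1))
        = real (Suc j + n) + real (Suc j + n) * (real X / (real n + 1))"
      by (simp add: field_simps)
    ultimately show "real (Suc j + n) + \<Delta> * s \<le> real (Suc j + n) * ((real X + real n + 1) / (real n + 1))"
      using assms(5) by linarith
  qed (use M0 assms(3) in \<open>auto simp: B_def\<close>)
  also have "\<dots> = M * fact (j + Suc n) / s ^ (j + Suc n) * (B * ((real X + real n + 1) / (real n + 1)))"
    by (simp add: field_simps)
  also have "B * ((real X + real n + 1) / (real n + 1)) = real ((X + Suc n) choose Suc n)"
  proof -
    have "Suc n * (Suc (X + n) choose Suc n) = Suc (X + n) * ((X + n) choose n)"
      using Suc_times_binomial_eq[of "X + n" n] by (simp only: mult.commute)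
    then have "real (Suc n) * real (Suc (X + n) choose Suc n) = real (Suc (X + n)) * B"
      unfolding B_def by (metis of_nat_mult)
    then show ?thesis
      by (simp add: field_simps)
  qed
  finally show ?case
    by (simp add: n_def)
qed

text \<open>The coefficients in \<open>lin_diff_op_growth\<close> are bounded through the small disc
  by \<open>deriv_lin_diff_op_bound\<close> with \<open>j = 0\<close>. The factorials cancel, and
  the remaining loss is exponential in the number of operators, in \<open>X\<close> and in
  \<open>\<Delta> * R\<close>.\<close>

lemma lin_diff_op_doubling:
  assumes "g holomorphic_on UNIV" "lin_diff_op bs g = (\<lambda>_. 0)" "\<And>b. b \<in> set bs \<Longrightarrow> cmod b \<le> \<Delta>"
    and "\<And>z. z \<in> cball c s \<Longrightarrow> cmod (g z) \<le> M" "0 < s" "s \<le> R" "\<Delta> * s \<le> real X" "0 \<le> \<Delta>"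
    and z: "z \<in> cball c R"
  shows "cmod (g z) \<le> exp (\<Delta> * R) * 2 ^ X * (4 * R / s) ^ length bs * M"
proof -
  define n where "n = length bs"
  have M0: "M \<ge> 0"
    using assms(4)[of c] assms(5) norm_ge_zero[of "g c"] by (simp del: norm_ge_zero)
  have zR: "cmod (z - c) \<le> R"
    using z by (simp add: dist_norm norm_minus_commute)
  have t: "cmod (lin_diff_op (take k bs) g c) * cmod (z - c) ^ k / fact k \<le> M * 2 ^ (X + n) * (R / s) ^ n"
    if "k < n" for k
  proof -
    have lk: "length (take k bs) = k"
      using that by (simp add: n_def)
    have "cmod ((deriv ^^ 0) (lin_diff_op (take k bs) g) c) \<le>
        M * fact (0 + length (take k bs)) / s ^ (0 + length (take k bs)) *
        real ((X + length (take k bs)) choose length (take k bs))"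
      by (rule deriv_lin_diff_op_bound[OF assms(1,4,5) _ assms(7)]) (auto dest: in_set_takeD intro: assms(3))
    then have "cmod (lin_diff_op (take k bs) g c) * cmod (z - c) ^ k / fact k \<le>
        (M * fact k / s ^ k * real ((X + k) choose k)) * R ^ k / fact k"
      unfolding lk using zR M0 assms(5)
      by (intro divide_right_mono mult_mono power_mono) auto
    also have "\<dots> = M * real ((X + k) choose k) * (R / s) ^ k"
      by (simp add: power_divide)
    also have "\<dots> \<le> M * 2 ^ (X + n) * (R / s) ^ n"
    proof (intro mult_mono mult_left_mono)
      have "(X + k) choose k \<le> 2 ^ (X + k)"
        by (rule binomial_le_pow2)
      also have "\<dots> \<le> 2 ^ (X + n)"
        using that by (intro power_increasing) auto
      finally show "real ((X + k) choose k) \<le> 2 ^ (X + n)"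
        by (metis of_nat_le_iff of_nat_numeral of_nat_power)
      show "(R / s) ^ k \<le> (R / s) ^ n"
        using that assms(5,6) by (intro power_increasing) auto
    qed (use M0 assms(5,6) in auto)
    finally show ?thesis .
  qed
  have "cmod (g z) = cmod (g (c + (z - c)))"
    by simp
  also have "\<dots> \<le> exp (\<Delta> * cmod (z - c)) * (\<Sum>k<n. cmod (lin_diff_op (take k bs) g c) * cmod (z - c) ^ k / fact k)"
    unfolding n_def by (rule lin_diff_op_growth[OF assms(1-3)])
  also have "\<dots> \<le> exp (\<Delta> * R) * (\<Sum>k<n. M * 2 ^ (X + n) * (R / s) ^ n)"
    using zR assms(8) t by (intro mult_mono sum_mono) (auto intro!: sum_nonneg mult_left_mono)
  also have "\<dots> = exp (\<Delta> * R) * (real n * (M * 2 ^ (X + n) * (R / s) ^ n))"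
    by simp
  \<comment> \<open>The number of summands is absorbed into \<open>2 ^ n\<close>; together with the
    \<open>2 ^ n\<close> from the binomial coefficients this gives the 4 in the base.\<close>
  also have "\<dots> \<le> exp (\<Delta> * R) * (2 ^ n * (M * 2 ^ (X + n) * (R / s) ^ n))"
    using M0 assms(5,6) less_imp_le[OF of_nat_less_two_power[of n, where 'a = real]]
    by (intro mult_left_mono mult_right_mono) auto
  also have "\<dots> = exp (\<Delta> * R) * 2 ^ X * (2 * 2 * (R / s)) ^ n * M"
    by (simp only: power_add power_mult_distrib mult_ac)
  finally show ?thesis
    by (simp add: n_def)
qed

section \<open>Extension of bounds to larger polydiscs\<close>

text \<open>Induction on the set of coordinates already moved to the large disc. Each new coordinate
  varies alone and costs one factor \<open>A\<close>, which is why \<open>ext\<close> is required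
  for every frozen point and every bound \<open>M\<close>.\<close>

lemma polydisc_bound_extension:
  fixes \<Phi> :: "complex ^ ('n::finite) \<Rightarrow> complex"
  assumes ext: "\<And>j w M u. (\<And>u. u \<in> cball (c $ j) s \<Longrightarrow> cmod (\<Phi> (\<chi> i. if i = j then u else w $ i)) \<le> M) \<Longrightarrow>
      u \<in> cball (c $ j) R \<Longrightarrow> cmod (\<Phi> (\<chi> i. if i = j then u else w $ i)) \<le> A * M"
    and bound: "\<And>w. (\<And>i. w $ i \<in> cball (c $ i) s) \<Longrightarrow> cmod (\<Phi> w) \<le> M"
    and w: "\<And>i. w $ i \<in> cball (c $ i) R"
  shows "cmod (\<Phi> w) \<le> A ^ CARD('n) * M"
proof -
  have "cmod (\<Phi> w) \<le> A ^ card S * M"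
    if "\<And>i. i \<in> S \<Longrightarrow> w $ i \<in> cball (c $ i) R" "\<And>i. i \<notin> S \<Longrightarrow> w $ i \<in> cball (c $ i) s"
    for S :: "'n set" and w
    using finite[of S] that
  proof (induction S arbitrary: w rule: finite_induct)
    case empty
    then show ?case using bound by simp
  next
    case (insert j S)
    have "cmod (\<Phi> (\<chi> i. if i = j then w $ j else w $ i)) \<le> A * (A ^ card S * M)"
    proof (rule ext)
      show "w $ j \<in> cball (c $ j) R" by (rule insert.prems) simp
      fix u assume u: "u \<in> cball (c $ j) s"
      show "cmod (\<Phi> (\<chi> i. if i = j then u else w $ i)) \<le> A ^ card S * M"
      proof (rule insert.IH)
        fix i assume "i \<in> S"
        with insert.prems(1)[of i] insert.hyps(2)
        show "(\<chi> i. if i = j then u else w $ i) $ i \<in> cball (c $ i) R" by auto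
      next
        fix i assume "i \<notin> S"
        with insert.prems(2)[of i] u
        show "(\<chi> i. if i = j then u else w $ i) $ i \<in> cball (c $ i) s" by auto
      qed
    qed
    moreover have "(\<chi> i. if i = j then w $ j else w $ i) = w"
      by (simp add: vec_eq_iff)
    ultimately show ?case
      using insert.hyps by (simp add: mult.assoc)
  qed
  from this[of UNIV w] w show ?thesis by simp
qed

section \<open>Frequencies and one-variable slices of exponential maps\<close>

lemma count_list_concat_replicate: "count_list (concat (replicate n xs)) x = n * count_list xs x"
  by (induction n) auto

lemma count_list_distinct: "distinct xs \<Longrightarrow> x \<in> set xs \<Longrightarrow> count_list xs x = 1"
  by (induction xs) (auto simp: count_list_0_iff)

text \<open>Each frequency is repeated \<open>K + 1\<close> times to annihilate polynomial
  coefficients of degree up to \<open>K\<close>. Different exponent vectors may give the same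
  frequency, so in general multiplicities are only bounded below; the exact value under injectivity
  serves the optimality argument.\<close>

lemma ex_frequency_list:
  fixes \<alpha> :: "'s \<Rightarrow> complex"
  assumes "finite S"
  obtains bs where
    "set bs = (\<lambda>b. \<Sum>s\<in>S. of_nat (b s) * \<alpha> s) ` (S \<rightarrow>\<^sub>E {..K})"
    "length bs = (K + 1) ^ (card S + 1)"
    "\<And>\<gamma>. \<gamma> \<in> set bs \<Longrightarrow> K < count_list bs \<gamma>"
    "inj_on (\<lambda>b. \<Sum>s\<in>S. of_nat (b s) * \<alpha> s) (S \<rightarrow>\<^sub>E {..K}) \<Longrightarrow>
       \<forall>\<gamma>\<in>set bs. count_list bs \<gamma> = K + 1"
proof -
  let ?f = "\<lambda>b. \<Sum>s\<in>S. of_nat (b s) * \<alpha> s"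
  have fin: "finite (S \<rightarrow>\<^sub>E {..K})"
    using assms by (intro finite_PiE) auto
  obtain xs where xs: "set xs = S \<rightarrow>\<^sub>E {..K}" "distinct xs"
    using finite_distinct_list[OF fin] by blast
  define ys where "ys = map ?f xs"
  define bs where "bs = concat (replicate (K + 1) ys)"
  have lys: "length ys = (K + 1) ^ card S"
    using distinct_card[OF xs(2)] assms by (simp add: ys_def xs(1) card_PiE)
  have "length bs = (K + 1) * length ys"
    unfolding bs_def by (simp add: length_concat sum_list_replicate)
  then have 2: "length bs = (K + 1) ^ (card S + 1)"
    by (simp add: lys)
  have sbs: "set bs = set ys"
    by (auto simp: bs_def)
  then have 1: "set bs = ?f ` (S \<rightarrow>\<^sub>E {..K})"
    by (simp add: ys_def xs(1))
  have cnt: "count_list bs \<gamma> = (K + 1) * count_list ys \<gamma>" for \<gamma>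
    unfolding bs_def by (rule count_list_concat_replicate)
  have 3: "K < count_list bs \<gamma>" if "\<gamma> \<in> set bs" for \<gamma>
  proof -
    have "count_list ys \<gamma> \<noteq> 0"
      using that sbs by (simp add: count_list_0_iff)
    then have "(K + 1) * 1 \<le> count_list bs \<gamma>"
      unfolding cnt by (intro mult_le_mono2) simp
    then show ?thesis by simp
  qed
  have 4: "\<forall>\<gamma>\<in>set bs. count_list bs \<gamma> = K + 1" if "inj_on ?f (S \<rightarrow>\<^sub>E {..K})"
  proof -
    have "distinct ys"
      using that xs by (simp add: ys_def distinct_map)
    then show ?thesis
      by (simp add: sbs cnt count_list_distinct)
  qed
  from that[OF 1 2 3 4] show thesis .
qed

text \<open>A flat form of the product map: \<open>J s\<close> is the variable on which coordinate
  \<open>s\<close> depends, so the fibres of \<open>J\<close> are the factors.\<close>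

definition exp_map :: "('m::finite \<Rightarrow> complex) \<Rightarrow> ('m \<Rightarrow> 'l::finite) \<Rightarrow> complex ^ 'l \<Rightarrow> complex ^ 'm" where
  "exp_map \<alpha> J z = (\<chi> s. exp (\<alpha> s * z $ J s))"

lemma prod_UNIV_sum:
  fixes g :: "'a::finite + 'b::finite \<Rightarrow> 'c::comm_monoid_mult"
  shows "(\<Prod>v\<in>UNIV. g v) = (\<Prod>a\<in>UNIV. g (Inl a)) * (\<Prod>b\<in>UNIV. g (Inr b))"
  by (subst UNIV_Plus_UNIV[symmetric], subst prod.Plus) auto

text \<open>Only the exponentials with \<open>J s = j\<close> see the moving variable; all other
  factors go into \<open>\<kappa>\<close>. Hence the size of one fibre, not the total number of
  exponentials, determines the exponent.\<close>

lemma monomial_exp_map_slice: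
  fixes J :: "'m::finite \<Rightarrow> 'l::finite"
  shows "\<exists>\<kappa>. \<forall>u. (\<Prod>v\<in>UNIV. (graph_point (exp_map \<alpha> J) (\<chi> i. if i = j then u else w $ i) $ v) ^ a v)
    = \<kappa> * (u ^ a (Inl j) * exp ((\<Sum>s\<in>{s. J s = j}. of_nat (a (Inr s)) * \<alpha> s) * u))"
proof (intro exI allI)
  fix u
  let ?S = "{s. J s = j}"
  let ?w = "\<chi> i. if i = j then u else w $ i"
  have 1: "(\<Prod>i\<in>UNIV. (?w $ i) ^ a (Inl i)) = u ^ a (Inl j) * (\<Prod>i\<in>UNIV-{j}. (w $ i) ^ a (Inl i))"
    by (subst prod.remove[of _ j]) auto
  have 2: "exp (\<alpha> s * ?w $ J s) ^ a (Inr s) = exp (of_nat (a (Inr s)) * \<alpha> s * ?w $ J s)" for s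
    by (simp add: exp_of_nat_mult[symmetric] mult.assoc)
  have "(\<Prod>s\<in>UNIV. exp (\<alpha> s * ?w $ J s) ^ a (Inr s))
      = (\<Prod>s\<in>?S. exp (of_nat (a (Inr s)) * \<alpha> s * ?w $ J s)) * (\<Prod>s\<in>-?S. exp (of_nat (a (Inr s)) * \<alpha> s * ?w $ J s))"
    unfolding 2 by (subst prod.union_disjoint[symmetric]) (auto intro: prod.cong)
  also have "(\<Prod>s\<in>?S. exp (of_nat (a (Inr s)) * \<alpha> s * ?w $ J s)) = exp ((\<Sum>s\<in>?S. of_nat (a (Inr s)) * \<alpha> s) * u)"
    by (simp add: exp_sum sum_distrib_right)
  also have "(\<Prod>s\<in>-?S. exp (of_nat (a (Inr s)) * \<alpha> s * ?w $ J s)) = (\<Prod>s\<in>-?S. exp (of_nat (a (Inr s)) * \<alpha> s * w $ J s))"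
    by (intro prod.cong) auto
  finally show "(\<Prod>v\<in>UNIV. (graph_point (exp_map \<alpha> J) ?w $ v) ^ a v)
      = ((\<Prod>i\<in>UNIV-{j}. (w $ i) ^ a (Inl i)) * (\<Prod>s\<in>-?S. exp (of_nat (a (Inr s)) * \<alpha> s * w $ J s))) *
        (u ^ a (Inl j) * exp ((\<Sum>s\<in>?S. of_nat (a (Inr s)) * \<alpha> s) * u))"
    unfolding prod_UNIV_sum using 1 by (simp add: graph_point_def exp_map_def mult_ac)
qed

text \<open>A slice is an exponential polynomial annihilated by the operators of
  \<open>ex_frequency_list\<close>, whose frequencies have modulus at most \<open>K\<close> times
  the sum of the moduli of \<alpha>. Thus \<open>lin_diff_op_doubling\<close> applies.\<close>

lemma exp_map_slice_doubling:
  fixes J :: "'m::finite \<Rightarrow> 'l::finite" and q :: "('l + 'm) cpoly"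
  assumes deg: "cpoly_degree q \<le> K" and sR: "0 < s" "s \<le> R"
    and m: "card {s. J s = j} \<le> m"
    and X: "real K * (\<Sum>s\<in>UNIV. cmod (\<alpha> s)) * s \<le> real X"
    and M: "\<And>u. u \<in> cball c s \<Longrightarrow>
      cmod (cpoly_eval q (graph_point (exp_map \<alpha> J) (\<chi> i. if i = j then u else w $ i))) \<le> M"
    and z: "z \<in> cball c R"
  shows "cmod (cpoly_eval q (graph_point (exp_map \<alpha> J) (\<chi> i. if i = j then z else w $ i)))
    \<le> exp (real K * (\<Sum>s\<in>UNIV. cmod (\<alpha> s)) * R) * 2 ^ X * (4 * R / s) ^ ((K + 1) ^ (m + 1)) * M"
proof -
  let ?l = "Poly_Mapping.lookup"
  define S where "S = {s. J s = j}"
  define \<Delta> where "\<Delta> = real K * (\<Sum>s\<in>UNIV. cmod (\<alpha> s))"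
  define g where "g = (\<lambda>u. cpoly_eval q (graph_point (exp_map \<alpha> J) (\<chi> i. if i = j then u else w $ i)))"
  define \<gamma> where "\<gamma> = (\<lambda>a :: ('l + 'm) \<Rightarrow>\<^sub>0 nat. \<Sum>s\<in>S. of_nat (?l a (Inr s)) * \<alpha> s)"
  have "\<forall>a. \<exists>\<kappa>. \<forall>u.
      (\<Prod>v\<in>UNIV. (graph_point (exp_map \<alpha> J) (\<chi> i. if i = j then u else w $ i) $ v) ^ ?l a v)
      = \<kappa> * (u ^ ?l a (Inl j) * exp (\<gamma> a * u))"
    unfolding \<gamma>_def S_def by (intro allI monomial_exp_map_slice)
  from choice[OF this] obtain \<kappa> where \<kappa>: "\<And>a u.
      (\<Prod>v\<in>UNIV. (graph_point (exp_map \<alpha> J) (\<chi> i. if i = j then u else w $ i) $ v) ^ ?l a v)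
      = \<kappa> a * (u ^ ?l a (Inl j) * exp (\<gamma> a * u))"
    by auto
  define p where "p = (\<lambda>a. monom (?l q a * \<kappa> a) (?l a (Inl j)))"
  have g: "g = (\<lambda>u. \<Sum>a\<in>Poly_Mapping.keys q. poly (p a) u * exp (\<gamma> a * u))"
    unfolding g_def cpoly_eval_def \<kappa> p_def by (simp add: poly_monom mult_ac)
  obtain bs where bs: "set bs = (\<lambda>b. \<Sum>s\<in>S. of_nat (b s) * \<alpha> s) ` (S \<rightarrow>\<^sub>E {..K})"
    "length bs = (K + 1) ^ (card S + 1)" "\<And>\<gamma>. \<gamma> \<in> set bs \<Longrightarrow> K < count_list bs \<gamma>"
    by (rule ex_frequency_list[of S \<alpha> K, OF finite]) blast
  have le: "?l a v \<le> K" if "a \<in> Poly_Mapping.keys q" for a v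
  proof -
    have "?l a v \<le> (\<Sum>v\<in>UNIV. ?l a v)"
      by (rule member_le_sum) auto
    also have "\<dots> \<le> K"
      using deg that unfolding cpoly_degree_le_iff by blast
    finally show ?thesis .
  qed
  have hol: "(\<lambda>u. poly (p a) u * exp (\<gamma> a * u)) holomorphic_on UNIV" for a
    by (intro holomorphic_intros)
  have "lin_diff_op bs (\<lambda>u. poly (p a) u * exp (\<gamma> a * u)) = (\<lambda>_. 0)" if a: "a \<in> Poly_Mapping.keys q" for a
  proof (rule lin_diff_op_poly_exp)
    have "\<gamma> a = (\<Sum>s\<in>S. of_nat ((\<lambda>s\<in>S. ?l a (Inr s)) s) * \<alpha> s)"
      unfolding \<gamma>_def by (intro sum.cong) auto
    moreover have "(\<lambda>s\<in>S. ?l a (Inr s)) \<in> S \<rightarrow>\<^sub>E {..K}"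
      using le[OF a] by auto
    ultimately have "\<gamma> a \<in> set bs"
      unfolding bs(1) by (rule image_eqI)
    moreover have "degree (p a) \<le> K"
      unfolding p_def using le[OF a] degree_monom_le order_trans by blast
    ultimately show "p a = 0 \<or> degree (p a) < count_list bs (\<gamma> a)"
      using bs(3) by (meson le_less_trans)
  qed
  then have L: "lin_diff_op bs g = (\<lambda>_. 0)"
    unfolding g by (subst lin_diff_op_sum[OF hol]) simp
  have holg: "g holomorphic_on UNIV"
    unfolding g by (intro holomorphic_on_sum hol)
  have \<Delta>: "cmod b \<le> \<Delta>" if b: "b \<in> set bs" for b
  proof -
    obtain e where e: "e \<in> S \<rightarrow>\<^sub>E {..K}" "b = (\<Sum>s\<in>S. of_nat (e s) * \<alpha> s)"
      using b unfolding bs(1) by blast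
    have "cmod b \<le> (\<Sum>s\<in>S. real (e s) * cmod (\<alpha> s))"
      unfolding e(2) by (rule order_trans[OF norm_sum]) (simp add: norm_mult)
    also have "\<dots> \<le> (\<Sum>s\<in>S. real K * cmod (\<alpha> s))"
      using e(1) by (intro sum_mono mult_right_mono) auto
    also have "\<dots> \<le> (\<Sum>s\<in>UNIV. real K * cmod (\<alpha> s))"
      by (intro sum_mono2) auto
    finally show ?thesis
      by (simp add: \<Delta>_def sum_distrib_left)
  qed
  have M0: "M \<ge> 0"
    using M[of c] sR(1) by (auto intro: order_trans[OF norm_ge_zero])
  have "cmod (g z) \<le> exp (\<Delta> * R) * 2 ^ X * (4 * R / s) ^ length bs * M"
  proof (rule lin_diff_op_doubling[OF holg L \<Delta>])
    show "0 \<le> \<Delta>" unfolding \<Delta>_def by (intro mult_nonneg_nonneg sum_nonneg) auto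
  qed (use M sR X z in \<open>auto simp: g_def \<Delta>_def\<close>)
  also have "\<dots> \<le> exp (\<Delta> * R) * 2 ^ X * (4 * R / s) ^ ((K + 1) ^ (m + 1)) * M"
  proof (intro mult_right_mono mult_left_mono power_increasing)
    show "length bs \<le> (K + 1) ^ (m + 1)"
      unfolding bs(2) S_def using m by (intro power_increasing) auto
  qed (use M0 sR in auto)
  finally show ?thesis
    by (simp add: g_def \<Delta>_def)
qed

section \<open>The Bernstein type inequality for composed exponential maps\<close>

lemma graph_max_degree_0:
  assumes "cpoly_degree p = 0" "0 \<le> r"
  shows "graph_max F p r = cmod (cpoly_eval p 0)"
proof -
  have "cpoly_eval p x = cpoly_eval p 0" for x
    unfolding cpoly_eval_def
  proof (intro sum.cong refl)
    fix a assume "a \<in> Poly_Mapping.keys p"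
    then have "Poly_Mapping.lookup a v = 0" for v
      using assms(1) cpoly_degree_le_iff[of p 0] by simp
    then show "Poly_Mapping.lookup p a * (\<Prod>v\<in>UNIV. x $ v ^ Poly_Mapping.lookup a v) =
      Poly_Mapping.lookup p a * (\<Prod>v\<in>UNIV. 0 $ v ^ Poly_Mapping.lookup a v)"
      by simp
  qed
  then have "graph_max F p r = (SUP z\<in>cball (0::complex^'a) r. cmod (cpoly_eval p 0))"
    unfolding graph_max_def by metis
  also have "\<dots> = cmod (cpoly_eval p 0)"
    using assms(2) by (intro cSUP_const) auto
  finally show ?thesis .
qed

lemma continuous_on_exp_map: "continuous_on S (exp_map \<alpha> J)"
  unfolding exp_map_def by (intro continuous_intros)

lemma norm_le_sum_norm: "norm x \<le> (\<Sum>i\<in>UNIV. norm (x $ i))"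
  for x :: "'a::real_normed_vector ^ 'n::finite"
  unfolding norm_vec_def by (rule L2_set_le_sum) auto

text \<open>In the coordinates \<open>w = P z\<close> a polynomial on the graph becomes one on the
  graph of \<open>exp_map\<close>, of degree at most \<open>D\<close> times as large. A small
  polydisc about \<open>P 0\<close> whose preimage lies in the ball of radius \<open>r\<close>
  controls a large one containing the image of the ball of radius \<open>exp 1 * r\<close>.\<close>

lemma admits_bernstein_exp_map:
  fixes J :: "'m::finite \<Rightarrow> 'l::finite"
  assumes P: "polynomial_automorphism P" and Q: "polynomial_automorphism Q"
    and m: "\<And>j. card {s. J s = j} \<le> m"
  shows "admits_bernstein (Q \<circ> exp_map \<alpha> J \<circ> P) (\<lambda>k. real (k ^ (m + 1)))"
  unfolding admits_bernstein_def
proof (intro conjI allI impI)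
  fix r :: real assume r: "0 < r"
  define F where "F = Q \<circ> exp_map \<alpha> J \<circ> P"
  have bij: "bij P" and pP: "polynomial_map P" "polynomial_map (inv P)" and pQ: "polynomial_map Q"
    using P Q unfolding polynomial_automorphism_def by auto
  have invP: "inv P (P z) = z" "P (inv P z) = z" for z
    using bij by (simp_all add: bij_is_inj bij_is_surj surj_f_inv_f)
  have contF: "continuous_on UNIV F"
    unfolding F_def
    by (intro continuous_on_compose continuous_on_polynomial_map pP pQ continuous_on_exp_map)
  define c where "c = P 0"
  have "continuous (at c) (inv P)"
    using continuous_on_polynomial_map[OF pP(2), of UNIV] by (simp add: continuous_on_eq_continuous_at)
  then obtain \<delta> where \<delta>: "\<delta> > 0" "\<And>w. dist w c < \<delta> \<Longrightarrow> dist (inv P w) (inv P c) < r"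
    using r unfolding continuous_at_eps_delta by blast
  \<comment> \<open>The norm is at most the sum of the coordinate moduli, so the polydisc of radius
    \<open>s\<close> lies in the open \<delta>-ball about \<open>c\<close>; the added 1 makes the
    inclusion strict.\<close>
  define s where "s = \<delta> / (real CARD('l) + 1)"
  have s: "s > 0" "real CARD('l) * s < \<delta>"
    using \<delta>(1) by (auto simp: s_def field_simps)
  have small: "inv P w \<in> cball 0 r" if "\<And>i. w $ i \<in> cball (c $ i) s" for w
  proof -
    have "dist w c \<le> (\<Sum>i\<in>UNIV. norm ((w - c) $ i))"
      unfolding dist_norm by (rule norm_le_sum_norm)
    also have "\<dots> \<le> (\<Sum>i\<in>(UNIV :: 'l set). s)"
      using that by (intro sum_mono) (simp add: dist_norm norm_minus_commute)
    finally have "dist w c < \<delta>"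
      using s(2) by simp
    from \<delta>(2)[OF this] show ?thesis
      by (simp add: c_def invP)
  qed
  have "compact (P ` cball 0 (exp 1 * r))"
    by (intro compact_continuous_image continuous_on_polynomial_map pP compact_cball)
  then obtain B where B: "\<And>z. z \<in> cball 0 (exp 1 * r) \<Longrightarrow> norm (P z) \<le> B"
    using compact_imp_bounded bounded_iff by (metis imageI)
  define R where "R = max s (norm c + B)"
  have R: "s \<le> R" "R > 0" using s by (auto simp: R_def)
  have large: "P z $ i \<in> cball (c $ i) R" if "z \<in> cball 0 (exp 1 * r)" for z i
  proof -
    have "dist (c $ i) (P z $ i) \<le> dist c (P z)"
      by (rule dist_vec_nth_le)
    also have "\<dots> \<le> norm c + B"
      using B[OF that] norm_triangle_ineq4[of c "P z"] by (simp add: dist_norm)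
    finally show ?thesis by (simp add: R_def)
  qed
  obtain D where D: "D \<ge> 1"
    "\<And>d g. poly_fun d g \<Longrightarrow> poly_fun (d * D) (\<lambda>x. g (block_map (inv P) Q x))"
    using poly_fun_block_map[OF pP(2) pQ] by blast
  define L where "L = (\<Sum>s\<in>UNIV. cmod (\<alpha> s))"
  have L0: "L \<ge> 0" unfolding L_def by (intro sum_nonneg) auto
  define X where "X = nat \<lceil>L * s\<rceil>"
  have X: "L * s \<le> real X" unfolding X_def by (rule real_nat_ceiling_ge)
  \<comment> \<open>This is the factor \<open>T\<close> below for \<open>k = 1\<close>; for larger
    \<open>k\<close> it is compared through \<open>T \<le> A ^ (k ^ (m + 1))\<close>.\<close>
  define A where "A = exp (real D * L * R) * 2 ^ (D * X) * (4 * R / s) ^ ((D + 1) ^ (m + 1))"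
  define C where "C = A ^ CARD('l)"
  have q1: "4 * R / s \<ge> 1" using s R by (simp add: field_simps)
  have "A \<ge> 1 * 1 * 1"
    unfolding A_def using L0 R q1 by (intro mult_mono one_le_power) auto
  then have A1: "A \<ge> 1" by simp
  then have C1: "C \<ge> 1" unfolding C_def by (rule one_le_power)
  have "graph_max F p (exp 1 * r) \<le> C powr real (cpoly_degree p ^ (m + 1)) * graph_max F p r" for p
  proof (cases "cpoly_degree p = 0")
    \<comment> \<open>The exponent is \<open>0 ^ (m + 1) = 0\<close>, so the factor is 1; the
      polynomial is constant and its two maxima agree.\<close>
    case True
    then show ?thesis using r C1 by (simp add: graph_max_degree_0)
  next
    case False
    define k where "k = cpoly_degree p"
    define K where "K = k * D"
    have k1: "k \<ge> 1" using False by (simp add: k_def)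
    have "poly_fun k (cpoly_eval p)"
      unfolding poly_fun_def k_def by (intro exI[of _ p]) auto
    from D(2)[OF this] obtain q where q: "cpoly_degree q \<le> K" "\<And>x. cpoly_eval q x = cpoly_eval p (block_map (inv P) Q x)"
      unfolding poly_fun_def K_def by blast
    have qe: "cpoly_eval q (graph_point (exp_map \<alpha> J) w) = cpoly_eval p (graph_point F (inv P w))" for w
    proof -
      have "block_map (inv P) Q (graph_point (exp_map \<alpha> J) w) = graph_point F (inv P w)"
        unfolding block_map_graph_point graph_point_def[of F] by (simp add: F_def invP)
      then show ?thesis by (simp add: q(2))
    qed
    define T where "T = exp (real K * L * R) * 2 ^ (K * X) * (4 * R / s) ^ ((K + 1) ^ (m + 1))"
    obtain z where z: "norm z \<le> exp 1 * r" "cmod (cpoly_eval p (graph_point F z)) = graph_max F p (exp 1 * r)"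
      using graph_max_attained(1)[OF contF, of "exp 1 * r" p] r by auto
    have "cmod (cpoly_eval q (graph_point (exp_map \<alpha> J) (P z))) \<le> T ^ CARD('l) * graph_max F p r"
    proof (rule polydisc_bound_extension[where c = c and s = s and R = R])
      fix j w M u
      assume M: "\<And>u. u \<in> cball (c $ j) s \<Longrightarrow>
          cmod (cpoly_eval q (graph_point (exp_map \<alpha> J) (\<chi> i. if i = j then u else w $ i))) \<le> M"
        and u: "u \<in> cball (c $ j) R"
      have "real K * (L * s) \<le> real K * real X"
        by (intro mult_left_mono X) auto
      then have "real K * L * s \<le> real (K * X)"
        by (simp add: mult.assoc)
      then show "cmod (cpoly_eval q (graph_point (exp_map \<alpha> J) (\<chi> i. if i = j then u else w $ i))) \<le> T * M"
        unfolding T_def L_def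
        by (rule exp_map_slice_doubling[OF q(1) s(1) R(1) m _ M u])
    next
      fix w assume "\<And>i. w $ i \<in> cball (c $ i) s"
      then have "norm (inv P w) \<le> r" using small by force
      then show "cmod (cpoly_eval q (graph_point (exp_map \<alpha> J) w)) \<le> graph_max F p r"
        unfolding qe using graph_max_attained(2)[OF contF] r by simp
    next
      fix i show "P z $ i \<in> cball (c $ i) R"
        using z(1) by (intro large) simp
    qed
    then have "graph_max F p (exp 1 * r) \<le> T ^ CARD('l) * graph_max F p r"
      by (simp add: qe invP z(2))
    also have "\<dots> \<le> (A ^ (k ^ (m + 1))) ^ CARD('l) * graph_max F p r"
    proof (intro mult_right_mono power_mono)
      have k': "k \<le> k ^ (m + 1)"
        using k1 by (intro self_le_power) auto
      \<comment> \<open>Here \<open>k \<ge> 1\<close> gives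
        \<open>k * D + 1 \<le> k * (D + 1)\<close>. This is the only factor that needs the full
        power of \<open>k\<close>; the other two are linear in \<open>k\<close> in the
        exponent.\<close>
      have "(K + 1) ^ (m + 1) \<le> (k * (D + 1)) ^ (m + 1)"
        unfolding K_def using k1 by (intro power_mono) auto
      also have "\<dots> = (D + 1) ^ (m + 1) * k ^ (m + 1)"
        by (simp only: power_mult_distrib mult.commute)
      finally have 1: "(4 * R / s) ^ ((K + 1) ^ (m + 1)) \<le> ((4 * R / s) ^ ((D + 1) ^ (m + 1))) ^ (k ^ (m + 1))"
        unfolding power_mult[symmetric] by (intro power_increasing q1)
      have "K * X \<le> D * X * k ^ (m + 1)"
        unfolding K_def using mult_le_mono2[OF k', of "D * X"] by (simp only: mult_ac)
      then have 2: "(2::real) ^ (K * X) \<le> (2 ^ (D * X)) ^ (k ^ (m + 1))"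
        unfolding power_mult[symmetric] by (intro power_increasing) auto
      have "real K * L * R \<le> real (k ^ (m + 1)) * (real D * L * R)"
      proof -
        have "real k * (real D * L * R) \<le> real (k ^ (m + 1)) * (real D * L * R)"
          using L0 R by (intro mult_right_mono of_nat_mono[OF k']) auto
        then show ?thesis by (simp add: K_def mult_ac)
      qed
      then have 3: "exp (real K * L * R) \<le> exp (real D * L * R) ^ (k ^ (m + 1))"
        by (simp only: exp_of_nat_mult[symmetric] exp_le_cancel_iff)
      show "T \<le> A ^ (k ^ (m + 1))"
        unfolding T_def A_def power_mult_distrib using q1 by (intro mult_mono 1 2 3) auto
      show "0 \<le> T" unfolding T_def using q1 by auto
      show "0 \<le> graph_max F p r" using graph_max_nonneg[OF contF] r by simp
    qed
    also have "(A ^ (k ^ (m + 1))) ^ CARD('l) = C ^ (k ^ (m + 1))"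
      by (simp only: C_def power_mult[symmetric] mult.commute)
    also have "\<dots> = C powr real (k ^ (m + 1))"
      using C1 by (intro powr_realpow[symmetric]) simp
    finally show ?thesis by (simp add: k_def)
  qed
  then show "\<exists>C\<ge>0. \<forall>p. graph_max (Q \<circ> exp_map \<alpha> J \<circ> P) p (exp 1 * r)
      \<le> C powr real (cpoly_degree p ^ (m + 1)) * graph_max (Q \<circ> exp_map \<alpha> J \<circ> P) p r"
    using C1 unfolding F_def by (intro exI[of _ C]) auto
qed simp

section \<open>Exponential polynomials with a zero of maximal order\<close>

text \<open>The resonant case of g' - b g = h: at the frequency b the degree may rise by one, as
  does the multiplicity of b.\<close>

lemma poly_antiderivative:
  fixes p :: "complex poly"
  shows "\<exists>q. pderiv q = p \<and> degree q \<le> Suc (degree p)"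
proof (intro exI conjI)
  let ?q = "\<Sum>i\<le>degree p. monom (coeff p i / of_nat (Suc i)) (Suc i)"
  have "pderiv ?q = (\<Sum>i\<le>degree p. monom (coeff p i) i)"
    by (simp add: higher_pderiv_sum[of 1, simplified] pderiv_monom del: of_nat_Suc)
  then show "pderiv ?q = p"
    by (simp add: poly_as_sum_of_monoms)
  show "degree ?q \<le> Suc (degree p)"
    by (intro degree_sum_le) (auto intro: order_trans[OF degree_monom_le])
qed

text \<open>The non-resonant case: if \<open>r\<close> solves the equation with right-hand side
  \<open>pderiv p\<close>, then \<open>(p - r) / \<delta>\<close> solves it for \<open>p\<close>,
  without raising the degree.\<close>

lemma poly_first_order_ode:
  fixes p :: "complex poly"
  assumes "\<delta> \<noteq> 0"
  shows "\<exists>q. pderiv q + smult \<delta> q = p \<and> degree q \<le> degree p"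
proof (induction "degree p" arbitrary: p rule: less_induct)
  case less
  show ?case
  proof (cases "degree p = 0")
    case True
    then have "pderiv p = 0"
      by (simp add: pderiv_eq_0_iff)
    then show ?thesis
      using assms by (intro exI[of _ "smult (1 / \<delta>) p"]) (simp add: pderiv_smult)
  next
    case False
    then have "degree (pderiv p) < degree p"
      by (simp add: degree_pderiv)
    from less[OF this] obtain r where r: "pderiv r + smult \<delta> r = pderiv p" "degree r \<le> degree (pderiv p)"
      by blast
    let ?q = "smult (1 / \<delta>) (p - r)"
    have "pderiv ?q + smult \<delta> ?q = smult (1 / \<delta>) (pderiv p - pderiv r) + (p - r)"
      using assms by (simp add: pderiv_smult pderiv_diff)
    also have "pderiv p - pderiv r = smult \<delta> r"
      by (simp add: r(1)[symmetric])
    finally have "pderiv ?q + smult \<delta> ?q = p"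
      using assms by simp
    moreover have "degree ?q \<le> degree p"
      using r(2) by (auto simp: degree_pderiv intro!: degree_diff_le)
    ultimately show ?thesis by blast
  qed
qed

definition exp_poly :: "complex set \<Rightarrow> (complex \<Rightarrow> complex poly) \<Rightarrow> complex \<Rightarrow> complex" where
  "exp_poly A p w = (\<Sum>\<gamma>\<in>A. poly (p \<gamma>) w * exp (\<gamma> * w))"

lemma holomorphic_exp_poly: "exp_poly A p holomorphic_on S"
  unfolding exp_poly_def by (intro holomorphic_intros)

lemma DERIV_exp_poly:
  "(exp_poly A p has_field_derivative exp_poly A (\<lambda>\<gamma>. pderiv (p \<gamma>) + smult \<gamma> (p \<gamma>)) w) (at w)"
  unfolding exp_poly_def by (intro DERIV_sum DERIV_poly_exp)

lemma norm_exp_mult_le: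
  "w \<in> cball c 1 \<Longrightarrow> cmod (exp (b * w)) \<le> exp (cmod b * (cmod c + 1))"
proof -
  assume "w \<in> cball c 1"
  then have "cmod w \<le> cmod c + 1"
    using norm_triangle_ineq2[of w c] by (simp add: dist_norm norm_minus_commute)
  then have "cmod (b * w) \<le> cmod b * (cmod c + 1)"
    by (simp add: norm_mult mult_left_mono)
  then show ?thesis
    using norm_exp[of "b * w"] by (meson exp_le_cancel_iff order_trans)
qed

text \<open>The constructed function is the divided difference of \<open>t \<mapsto> exp (t (w - c))\<close> at the nodes
  \<open>bs\<close>, up to a factor. It arises by solving \<open>g' - b g = h\<close>, \<open>g c = 0\<close>, once for each node.\<close>

lemma ex_exp_poly_high_order_zero:
  assumes "bs \<noteq> []"
  shows "\<exists>p C. (\<forall>\<gamma>\<in>set bs. degree (p \<gamma>) < count_list bs \<gamma>) \<and> (\<exists>w. exp_poly (set bs) p w \<noteq> 0) \<and>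
    C \<ge> 0 \<and> (\<forall>w\<in>cball c 1. cmod (exp_poly (set bs) p w) \<le> C * cmod (w - c) ^ (length bs - 1))"
  using assms
proof (induction bs rule: list_nonempty_induct)
  case (single b)
  show ?case
    by (intro exI[of _ "\<lambda>_. 1"] exI[of _ "exp (cmod b * (cmod c + 1))"])
      (auto simp: exp_poly_def norm_exp_mult_le simp del: norm_exp_eq_Re)
next
  case (cons b bs)
  then obtain p C where p: "\<And>\<gamma>. \<gamma> \<in> set bs \<Longrightarrow> degree (p \<gamma>) < count_list bs \<gamma>"
    and nz: "\<exists>w. exp_poly (set bs) p w \<noteq> 0" and C: "C \<ge> 0"
    "\<And>w. w \<in> cball c 1 \<Longrightarrow> cmod (exp_poly (set bs) p w) \<le> C * cmod (w - c) ^ (length bs - 1)"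
    by blast
  define h where "h = exp_poly (set bs) p"
  define A where "A = set (b # bs)"
  define N where "N = length bs"
  \<comment> \<open>The equation g' - b g = h, frequency by frequency. Degrees rise only at
    \<open>\<gamma> = b\<close>, where the multiplicity grows too; a frequency b new to the list
    starts with coefficient 0.\<close>
  have "\<exists>q. pderiv q + smult (\<gamma> - b) q = (if \<gamma> \<in> set bs then p \<gamma> else 0) \<and>
      degree q < count_list (b # bs) \<gamma>" if "\<gamma> \<in> A" for \<gamma>
  proof (cases "\<gamma> \<in> set bs")
    case True
    show ?thesis
    proof (cases "\<gamma> = b")
      case True
      then show ?thesis
        using poly_antiderivative[of "p \<gamma>"] p[OF \<open>\<gamma> \<in> set bs\<close>] \<open>\<gamma> \<in> set bs\<close>
        by (auto intro: le_less_trans)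
    next
      case False
      then show ?thesis
        using poly_first_order_ode[of "\<gamma> - b" "p \<gamma>"] p[OF \<open>\<gamma> \<in> set bs\<close>] \<open>\<gamma> \<in> set bs\<close>
        by (auto intro: le_less_trans)
    qed
  next
    case False
    with that have "\<gamma> = b" by (simp add: A_def)
    with False show ?thesis by (intro exI[of _ 0]) auto
  qed
  then obtain q where q: "\<And>\<gamma>. \<gamma> \<in> A \<Longrightarrow> pderiv (q \<gamma>) + smult (\<gamma> - b) (q \<gamma>) = (if \<gamma> \<in> set bs then p \<gamma> else 0)"
    "\<And>\<gamma>. \<gamma> \<in> A \<Longrightarrow> degree (q \<gamma>) < count_list (b # bs) \<gamma>"
    by metis
  \<comment> \<open>\<open>a * exp (b * w)\<close> solves the homogeneous equation, and subtracting
    it makes \<open>g\<close> vanish at \<open>c\<close>. Only the constant term of the coefficient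
    at \<open>b\<close> changes, so the degree bound survives.\<close>
  define a where "a = exp_poly A q c * exp (- b * c)"
  define q' where "q' = q(b := q b - [:a:])"
  define g where "g = exp_poly A q'"
  have finA: "finite A" "b \<in> A" by (auto simp: A_def)
  have g_eq: "g w = exp_poly A q w - a * exp (b * w)" for w
  proof -
    have "(\<Sum>\<gamma>\<in>A - {b}. poly (q' \<gamma>) w * exp (\<gamma> * w)) = (\<Sum>\<gamma>\<in>A - {b}. poly (q \<gamma>) w * exp (\<gamma> * w))"
      by (intro sum.cong) (auto simp: q'_def)
    then show ?thesis
      unfolding g_def exp_poly_def sum.remove[OF finA] by (simp add: q'_def algebra_simps)
  qed
  have gc: "g c = 0"
    unfolding g_eq a_def by (simp add: exp_minus field_simps)
  have dg: "(g has_field_derivative b * g w + h w) (at w)" for w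
  proof -
    have "exp_poly A (\<lambda>\<gamma>. pderiv (q \<gamma>) + smult \<gamma> (q \<gamma>)) w - b * exp_poly A q w
        = (\<Sum>\<gamma>\<in>A. poly (pderiv (q \<gamma>) + smult (\<gamma> - b) (q \<gamma>)) w * exp (\<gamma> * w))"
      unfolding exp_poly_def by (simp add: sum_distrib_left sum_subtractf[symmetric] algebra_simps)
    also have "\<dots> = (\<Sum>\<gamma>\<in>A. if \<gamma> \<in> set bs then poly (p \<gamma>) w * exp (\<gamma> * w) else 0)"
      by (intro sum.cong refl) (simp add: q(1))
    also have "\<dots> = h w"
      unfolding h_def exp_poly_def by (subst sum.inter_restrict[OF finA(1), symmetric]) (auto simp: A_def intro: sum.cong)
    finally have *: "exp_poly A (\<lambda>\<gamma>. pderiv (q \<gamma>) + smult \<gamma> (q \<gamma>)) w = b * exp_poly A q w + h w"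
      by (simp add: algebra_simps)
    have "((\<lambda>w. exp_poly A q w - a * exp (b * w)) has_field_derivative
        exp_poly A (\<lambda>\<gamma>. pderiv (q \<gamma>) + smult \<gamma> (q \<gamma>)) w - a * (b * exp (b * w))) (at w)"
      by (rule derivative_eq_intros DERIV_exp_poly refl | simp)+
    moreover have "(\<lambda>w. exp_poly A q w - a * exp (b * w)) = g"
      using g_eq by (simp add: fun_eq_iff)
    ultimately show ?thesis
      by (simp add: * g_eq algebra_simps)
  qed
  define G where "G = (\<lambda>w. exp (- b * w) * g w)"
  have dG: "(G has_field_derivative exp (- b * w) * h w) (at w)" for w
  proof -
    have "((\<lambda>w. exp (- b * w)) has_field_derivative - b * exp (- b * w)) (at w)"
      by (auto intro!: derivative_eq_intros)
    from DERIV_mult[OF this dg] show ?thesis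
      unfolding G_def by (simp add: algebra_simps)
  qed
  have "\<exists>w. g w \<noteq> 0"
  proof (rule ccontr)
    assume "\<not> (\<exists>w. g w \<noteq> 0)"
    then have "G = (\<lambda>_. 0)" by (simp add: G_def)
    then have "(G has_field_derivative 0) (at w)" for w
      by simp
    then have "exp (- b * w) * h w = 0" for w
      by (rule DERIV_unique[OF dG])
    then show False using nz by (auto simp: h_def)
  qed
  moreover have "\<forall>\<gamma>\<in>A. degree (q' \<gamma>) < count_list (b # bs) \<gamma>"
  proof
    fix \<gamma> assume "\<gamma> \<in> A"
    have "degree (q b - [:a:]) \<le> degree (q b)"
      by (intro degree_diff_le) auto
    then show "degree (q' \<gamma>) < count_list (b # bs) \<gamma>"
      using q(2)[OF \<open>\<gamma> \<in> A\<close>] by (auto simp: q'_def intro: le_less_trans)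
  qed
  moreover define E where "E = exp (cmod b * (cmod c + 1))"
  have "cmod (g w) \<le> (E * (E * C)) * cmod (w - c) ^ N" if w: "w \<in> cball c 1" for w
  proof -
    have E: "cmod (exp (b * v)) \<le> E" "cmod (exp (- b * v)) \<le> E" if "v \<in> cball c 1" for v
      using norm_exp_mult_le[OF that, of b] norm_exp_mult_le[OF that, of "- b"] by (simp_all add: E_def)
    have wc: "cmod (w - c) \<le> 1"
      using w by (simp add: dist_norm norm_minus_commute)
    \<comment> \<open>\<open>G' = exp (- b * v) * h v\<close> is estimated on the disc of radius
      \<open>cmod (w - c)\<close>; the mean value bound gains one order of vanishing.\<close>
    have "cmod (G w - G c) \<le> (E * (C * cmod (w - c) ^ (N - 1))) * cmod (w - c)"
    proof (rule field_differentiable_bound)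
      show "convex (cball c (cmod (w - c)))" by (rule convex_cball)
      fix v assume v: "v \<in> cball c (cmod (w - c))"
      then have v1: "v \<in> cball c 1" and vc: "cmod (v - c) \<le> cmod (w - c)"
        using wc by (auto simp: dist_norm norm_minus_commute)
      show "(G has_field_derivative exp (- b * v) * h v) (at v within cball c (cmod (w - c)))"
        by (rule has_field_derivative_at_within[OF dG])
      have "cmod (h v) \<le> C * cmod (v - c) ^ (N - 1)"
        unfolding h_def N_def by (rule C(2)[OF v1])
      also have "\<dots> \<le> C * cmod (w - c) ^ (N - 1)"
        using C(1) vc by (intro mult_left_mono power_mono) auto
      finally show "cmod (exp (- b * v) * h v) \<le> E * (C * cmod (w - c) ^ (N - 1))"
        unfolding norm_mult using E(2)[OF v1] C(1) by (intro mult_mono) (auto simp: E_def)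
    qed (auto simp: dist_norm norm_minus_commute)
    \<comment> \<open>As \<open>bs\<close> is nonempty, the truncated \<open>N - 1\<close> plus one
      is \<open>N\<close>, which is the length of \<open>b # bs\<close> minus one.\<close>
    also have "\<dots> = E * C * cmod (w - c) ^ N"
      using cons.hyps unfolding N_def by (cases bs) auto
    finally have "cmod (G w) \<le> E * C * cmod (w - c) ^ N"
      by (simp add: G_def gc)
    moreover have "g w = exp (b * w) * G w"
      by (simp add: G_def exp_minus)
    ultimately have "cmod (g w) \<le> E * (E * C * cmod (w - c) ^ N)"
      using E(1)[OF w] by (simp only: norm_mult) (intro mult_mono, auto simp: E_def)
    then show ?thesis by (simp add: mult_ac)
  qed
  ultimately show ?case
    using C(1) unfolding g_def A_def N_def
    by (intro exI[of _ q'] exI[of _ "E * (E * C)"]) (auto simp: E_def)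
qed


section \<open>Growth of functions with a zero of high order\<close>

text \<open>The quotient of \<open>\<psi>\<close> by \<open>u ^ N\<close> is bounded near 0, so it
  extends to an entire function, and the maximum principle compares its value at 1 with the circle
  of radius \<open>R\<close>. The size of \<open>C\<close> does not enter the conclusion.\<close>

lemma entire_growth_of_zero:
  assumes "\<psi> holomorphic_on UNIV" "\<delta> > 0" "R \<ge> 1"
    and zero: "\<And>u. cmod u < \<delta> \<Longrightarrow> cmod (\<psi> u) \<le> C * cmod u ^ N"
    and bound: "\<And>u. cmod u = R \<Longrightarrow> cmod (\<psi> u) \<le> B"
  shows "R ^ N * cmod (\<psi> 1) \<le> B"
proof -
  define f where "f = (\<lambda>u. \<psi> u / u ^ N)"
  have "f holomorphic_on UNIV - {0}"
    unfolding f_def by (intro holomorphic_intros holomorphic_on_subset[OF assms(1)]) auto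
  moreover have "eventually (\<lambda>u. cmod (f u) \<le> C) (at 0)"
    unfolding eventually_at
  proof (intro exI conjI ballI impI)
    fix u :: complex assume "u \<noteq> 0 \<and> dist u 0 < \<delta>"
    then show "cmod (f u) \<le> C"
      using zero[of u] by (simp add: f_def norm_divide norm_power divide_le_eq)
  qed (rule assms(2))
  ultimately obtain \<phi> where \<phi>: "\<phi> holomorphic_on UNIV" "\<And>u. u \<noteq> 0 \<Longrightarrow> \<phi> u = f u"
    using holomorphic_on_extend_bounded[of f UNIV 0] by auto
  have "cmod (\<phi> 1) \<le> B / R ^ N"
  proof (rule maximum_modulus_frontier[of \<phi> "cball 0 R"])
    show "continuous_on (closure (cball 0 R)) \<phi>"
      by (intro holomorphic_on_imp_continuous_on holomorphic_on_subset[OF \<phi>(1)]) auto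
    fix u :: complex assume "u \<in> frontier (cball 0 R)"
    then have "cmod u = R" using assms(3) by simp
    with bound[OF this] assms(3) show "cmod (\<phi> u) \<le> B / R ^ N"
      by (subst \<phi>(2)) (auto simp: f_def norm_divide norm_power intro!: divide_right_mono)
  qed (use assms(3) in \<open>auto intro: holomorphic_on_subset[OF \<phi>(1)]\<close>)
  then show ?thesis
    using assms(3) by (simp add: \<phi>(2) f_def field_simps)
qed

text \<open>This transfers an order of vanishing through a substitution: a zero of order n in w
  becomes one of order at least n in u after w - c = \<open>\<pi> u\<close>.\<close>

lemma entire_zero_linear_bound:
  assumes "\<pi> holomorphic_on UNIV" "\<pi> 0 = 0"
  shows "\<exists>B\<ge>0. \<forall>u. cmod u \<le> 1 \<longrightarrow> cmod (\<pi> u) \<le> B * cmod u"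
proof -
  have "compact (deriv \<pi> ` cball 0 1)"
    by (intro compact_continuous_image holomorphic_on_imp_continuous_on
        holomorphic_on_subset[OF holomorphic_deriv[OF assms(1) open_UNIV]]) auto
  then obtain B where B: "\<And>u. u \<in> cball 0 1 \<Longrightarrow> cmod (deriv \<pi> u) \<le> B"
    using compact_imp_bounded bounded_iff by (metis imageI)
  have "cmod (\<pi> u - \<pi> 0) \<le> B * cmod (u - 0)" if "cmod u \<le> 1" for u
  proof (rule field_differentiable_bound[of "cball 0 1"])
    show "(\<pi> has_field_derivative deriv \<pi> v) (at v within cball 0 1)" for v
      by (rule has_field_derivative_at_within[OF entire_deriv[OF assms(1)]])
  qed (use that B in auto)
  moreover have "B \<ge> 0" using B[of 0] norm_ge_zero[of "deriv \<pi> 0"] by (simp del: norm_ge_zero)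
  ultimately show ?thesis
    using assms(2) by auto
qed

text \<open>The difference of two exponent vectors with the same frequency would be a rational
  linear relation among the values of \<alpha>.\<close>

lemma inj_on_frequencies:
  fixes \<alpha> :: "'s \<Rightarrow> complex"
  assumes "finite S" "inj_on \<alpha> S" "complex_over_rat.independent (\<alpha> ` S)"
  shows "inj_on (\<lambda>b. \<Sum>s\<in>S. of_nat (b s) * \<alpha> s) (S \<rightarrow>\<^sub>E B)"
proof (rule inj_onI)
  fix b b' assume b: "b \<in> S \<rightarrow>\<^sub>E B" "b' \<in> S \<rightarrow>\<^sub>E B"
    and eq: "(\<Sum>s\<in>S. of_nat (b s) * \<alpha> s) = (\<Sum>s\<in>S. of_nat (b' s) * \<alpha> s)"
  \<comment> \<open>Independence concerns the set of values, so the coefficients are indexed by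
    \<open>x = \<alpha> s\<close> and \<open>s\<close> is recovered from \<open>x\<close>.\<close>
  define u where "u = (\<lambda>x. let s = inv_into S \<alpha> x in of_nat (b s) - of_nat (b' s) :: rat)"
  have "(\<Sum>x\<in>\<alpha> ` S. of_rat (u x) * x) = (\<Sum>s\<in>S. of_rat (u (\<alpha> s)) * \<alpha> s)"
    by (simp add: sum.reindex[OF assms(2)])
  also have "\<dots> = (\<Sum>s\<in>S. of_nat (b s) * \<alpha> s - of_nat (b' s) * \<alpha> s)"
    by (intro sum.cong refl) (simp add: u_def inv_into_f_f[OF assms(2)] of_rat_diff algebra_simps)
  also have "\<dots> = 0"
    by (simp add: sum_subtractf eq)
  finally have sum0: "(\<Sum>x\<in>\<alpha> ` S. of_rat (u x) * x) = 0" .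
  have "b s = b' s" for s
  proof (cases "s \<in> S")
    case True
    have "u (\<alpha> s) = 0"
      using complex_over_rat.independentD[OF assms(3) _ subset_refl sum0] assms(1) True by simp
    then show ?thesis
      using True by (simp add: u_def inv_into_f_f[OF assms(2)])
  next
    case False
    then show ?thesis using PiE_arb[OF b(1)] PiE_arb[OF b(2)] by simp
  qed
  then show "b = b'" by (rule ext)
qed

section \<open>Optimality\<close>

text \<open>A function \<open>g\<close> of the single variable \<open>w $ j\<close> with a
  high-order zero at \<open>P 0 $ j\<close> is pulled back to the graph, where it vanishes to high
  order at \<open>z = 0\<close>. On the complex line through a point maximising over the ball of
  radius \<open>r\<close>, \<open>entire_growth_of_zero\<close> with radius \<open>exp 1\<close>
  gives the growth.\<close>

lemma ex_poly_large_growth: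
  fixes J :: "'m::finite \<Rightarrow> 'l::finite" and P :: "complex ^ 'l \<Rightarrow> complex ^ 'l"
  assumes P: "polynomial_automorphism P" and Q: "polynomial_automorphism Q"
    and indep: "inj_on \<alpha> {s. J s = j}" "complex_over_rat.independent (\<alpha> ` {s. J s = j})"
    and m: "card {s. J s = j} = m"
  shows "\<exists>E\<ge>1. \<forall>k\<ge>1. \<exists>p. cpoly_degree p = k \<and>
    (\<exists>z. cpoly_eval p (graph_point (Q \<circ> exp_map \<alpha> J \<circ> P) z) \<noteq> 0) \<and>
    (\<forall>r>0. exp 1 ^ (((k - 1) div E + 1) ^ (m + 1)) * graph_max (Q \<circ> exp_map \<alpha> J \<circ> P) p r
       \<le> graph_max (Q \<circ> exp_map \<alpha> J \<circ> P) p (exp 1 * r))"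
proof -
  define F where "F = Q \<circ> exp_map \<alpha> J \<circ> P"
  have bijP: "bij P" and pP: "polynomial_map P" and bijQ: "bij Q"
    and pQ: "polynomial_map Q" "polynomial_map (inv Q)"
    using P Q unfolding polynomial_automorphism_def by auto
  have invP: "P (inv P z) = z" for z
    using bijP by (simp add: bij_is_surj surj_f_inv_f)
  have invQ: "inv Q (Q z) = z" for z
    using bijQ by (simp add: bij_is_inj)
  have contF: "continuous_on UNIV F"
    unfolding F_def
    by (intro continuous_on_compose continuous_on_polynomial_map pP pQ continuous_on_exp_map)
  obtain D where D: "D \<ge> 1"
    "\<And>d g. poly_fun d g \<Longrightarrow> poly_fun (d * D) (\<lambda>x. g (block_map P (inv Q) x))"
    using poly_fun_block_map[OF pP pQ(2)] by blast
  \<comment> \<open>The test function has degree at most \<open>K\<close> in the variable plus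
    \<open>m * K\<close> in the exponentials, and pulling back multiplies this by \<open>D\<close>:
    in total \<open>K * E\<close>.\<close>
  define E where "E = (m + 1) * D"
  define S where "S = {s. J s = j}"
  define c where "c = P 0 $ j"
  have "\<exists>p. cpoly_degree p = k \<and> (\<exists>z. cpoly_eval p (graph_point F z) \<noteq> 0) \<and>
    (\<forall>r>0. exp 1 ^ (((k - 1) div E + 1) ^ (m + 1)) * graph_max F p r \<le> graph_max F p (exp 1 * r))"
    if k: "k \<ge> 1" for k
  proof -
    \<comment> \<open>With \<open>k - 1\<close> in place of \<open>k\<close> the degree stays below
      \<open>k\<close>, so at least one power of a coordinate must be multiplied on. It lifts the
      order of vanishing from \<open>N - 1\<close> to \<open>N\<close>.\<close>
    define K where "K = (k - 1) div E"
    let ?freq = "\<lambda>b. \<Sum>s\<in>S. of_nat (b s) * \<alpha> s"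
    have inj: "inj_on ?freq (S \<rightarrow>\<^sub>E {..K})"
      using indep unfolding S_def by (intro inj_on_frequencies) auto
    obtain bs where bs: "set bs = ?freq ` (S \<rightarrow>\<^sub>E {..K})" "length bs = (K + 1) ^ (card S + 1)"
      "\<forall>\<gamma>\<in>set bs. count_list bs \<gamma> = K + 1"
      by (rule ex_frequency_list[of S \<alpha> K, OF finite]) (use inj in blast)
    define N where "N = (K + 1) ^ (m + 1)"
    have N: "length bs = N" "N \<ge> 1"
      using bs(2) m by (simp_all add: N_def S_def del: power_Suc)
    then have "bs \<noteq> []" by auto
    from ex_exp_poly_high_order_zero[OF this, of c] obtain p C
      where p: "\<And>\<gamma>. \<gamma> \<in> set bs \<Longrightarrow> degree (p \<gamma>) < count_list bs \<gamma>"
        and nz: "\<exists>w. exp_poly (set bs) p w \<noteq> 0" and C: "C \<ge> 0"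
        "\<And>w. w \<in> cball c 1 \<Longrightarrow> cmod (exp_poly (set bs) p w) \<le> C * cmod (w - c) ^ (N - 1)"
      unfolding N(1) by blast
    define g where "g = exp_poly (set bs) p"
    \<comment> \<open>An exponent vector for each frequency, which turns
      \<open>exp (\<gamma> * w)\<close> into a monomial in the exponential coordinates.\<close>
    define b where "b = inv_into (S \<rightarrow>\<^sub>E {..K}) ?freq"
    have b: "b \<gamma> \<in> S \<rightarrow>\<^sub>E {..K}" "?freq (b \<gamma>) = \<gamma>" if "\<gamma> \<in> set bs" for \<gamma>
      using that inv_into_into[of \<gamma> ?freq "S \<rightarrow>\<^sub>E {..K}"] f_inv_into_f[of \<gamma> ?freq "S \<rightarrow>\<^sub>E {..K}"]
      unfolding bs(1) b_def by blast+
    define q where "q = (\<lambda>x :: complex ^ ('l + 'm).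
      \<Sum>\<gamma>\<in>set bs. poly (p \<gamma>) (x $ Inl j) * (\<Prod>s\<in>S. (x $ Inr s) ^ b \<gamma> s))"
    have q_exp: "q (graph_point (exp_map \<alpha> J) w) = g (w $ j)" for w
      unfolding q_def g_def exp_poly_def
    proof (intro sum.cong refl)
      fix \<gamma> assume \<gamma>: "\<gamma> \<in> set bs"
      have "(\<Prod>s\<in>S. (graph_point (exp_map \<alpha> J) w $ Inr s) ^ b \<gamma> s) = (\<Prod>s\<in>S. exp (of_nat (b \<gamma> s) * \<alpha> s * w $ j))"
        by (intro prod.cong refl) (simp add: graph_point_def exp_map_def S_def exp_of_nat_mult[symmetric] mult.assoc)
      also have "\<dots> = exp (?freq (b \<gamma>) * w $ j)"
        by (simp add: exp_sum sum_distrib_right)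
      finally have "(\<Prod>s\<in>S. (graph_point (exp_map \<alpha> J) w $ Inr s) ^ b \<gamma> s) = exp (\<gamma> * w $ j)"
        unfolding b(2)[OF \<gamma>] .
      then show "poly (p \<gamma>) (graph_point (exp_map \<alpha> J) w $ Inl j) *
          (\<Prod>s\<in>S. (graph_point (exp_map \<alpha> J) w $ Inr s) ^ b \<gamma> s) = poly (p \<gamma>) (w $ j) * exp (\<gamma> * w $ j)"
        by (simp add: graph_point_def)
    qed
    have "poly_fun (K + m * K) q"
      unfolding q_def
    proof (rule poly_fun_sum)
      fix \<gamma> assume \<gamma>: "\<gamma> \<in> set bs"
      \<comment> \<open>Rational independence enters here: the multiplicities are exactly
        \<open>K + 1\<close>.\<close>
      have "degree (p \<gamma>) \<le> K"
        using p[OF \<gamma>] bs(3) \<gamma> by simp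
      moreover have "(\<Sum>s\<in>S. b \<gamma> s * 1) \<le> m * K"
        using sum_bounded_above[of S "b \<gamma>" K] b(1)[OF \<gamma>] m by (auto simp: S_def)
      ultimately show "poly_fun (K + m * K) (\<lambda>x. poly (p \<gamma>) (x $ Inl j) * (\<Prod>s\<in>S. (x $ Inr s) ^ b \<gamma> s))"
        using poly_fun_mult[OF poly_fun_poly poly_fun_mono[OF poly_fun_prod[OF poly_fun_power[OF poly_fun_coord]]]]
        by blast
    qed
    from D(2)[OF this] obtain p0 where p0: "cpoly_degree p0 \<le> (K + m * K) * D"
      "\<And>x. cpoly_eval p0 x = q (block_map P (inv Q) x)"
      unfolding poly_fun_def by blast
    have p0F: "cpoly_eval p0 (graph_point F z) = g (P z $ j)" for z
    proof -
      have "block_map P (inv Q) (graph_point F z) = graph_point (exp_map \<alpha> J) (P z)"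
        unfolding block_map_graph_point graph_point_def[of "exp_map \<alpha> J"] by (simp add: F_def invQ)
      then show ?thesis by (simp add: p0(2) q_exp)
    qed
    have "(K + m * K) * D = K * E"
      by (simp add: E_def algebra_simps)
    also have "\<dots> \<le> k - 1"
      unfolding K_def by (rule div_times_less_eq_dividend)
    finally have deg0: "cpoly_degree p0 \<le> k - 1"
      using p0(1) by linarith
    obtain w where w: "g w \<noteq> 0" using nz by (auto simp: g_def)
    define z1 where "z1 = inv P (\<chi> i. w)"
    have z1: "g (P z1 $ j) \<noteq> 0" by (simp add: z1_def invP w)
    then have "p0 \<noteq> 0" using p0F[of z1] by auto
    define t where "t = k - cpoly_degree p0"
    have t: "t \<ge> 1" "cpoly_degree p0 + t = k" using deg0 k by (auto simp: t_def)
    from cpoly_shift_degree[OF \<open>p0 \<noteq> 0\<close>, of t "Inl j"] obtain p1 where p1: "cpoly_degree p1 = k"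
      "\<And>x. cpoly_eval p1 x = (x $ Inl j) ^ t * cpoly_eval p0 x"
      unfolding t(2) by blast
    have p1F: "cpoly_eval p1 (graph_point F z) = (z $ j) ^ t * g (P z $ j)" for z
      unfolding p1(2) p0F by (simp add: graph_point_def)
    obtain d where d: "\<And>i. poly_fun d (\<lambda>x. P x $ i)"
      using polynomial_map_imp_poly_fun[OF pP] by blast
    have holP: "(\<lambda>u. P (x u) $ i) holomorphic_on UNIV" if "\<And>i. (\<lambda>u. x u $ i) holomorphic_on UNIV" for x i
      by (rule holomorphic_poly_fun[OF d that])
    have holg: "(\<lambda>u. g (\<pi> u)) holomorphic_on UNIV" if "\<pi> holomorphic_on UNIV" for \<pi>
      using holomorphic_on_compose_gen[OF that, of g UNIV] holomorphic_exp_poly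
      unfolding g_def by (auto simp: o_def)
    have "\<exists>z. cpoly_eval p1 (graph_point F z) \<noteq> 0"
    proof -
      \<comment> \<open>The coordinate \<open>z1 $ j\<close> may be 0, which would kill the new
        factor. Moving it slightly makes it nonzero and, by continuity, keeps \<open>g\<close>
        nonzero.\<close>
      define x where "x = (\<lambda>u. \<chi> i. if i = j then z1 $ j + u else z1 $ i)"
      have "(\<lambda>u. x u $ i) holomorphic_on UNIV" for i
        by (cases "i = j") (auto simp: x_def intro!: holomorphic_intros)
      from holg[OF holP[OF this]] have "isCont (\<lambda>u. g (P (x u) $ j)) 0"
        using holomorphic_on_imp_continuous_on continuous_on_eq_continuous_at open_UNIV by blast
      moreover have "x 0 = z1" by (simp add: x_def vec_eq_iff)
      ultimately have "((\<lambda>u. g (P (x u) $ j)) \<longlongrightarrow> g (P z1 $ j)) (at 0)"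
        unfolding isCont_def by simp
      from tendsto_imp_eventually_ne[OF this z1]
      have "eventually (\<lambda>u. g (P (x u) $ j) \<noteq> 0 \<and> u \<noteq> - z1 $ j) (at 0)"
        by (rule eventually_conj) (rule eventually_neq_at_within)
      then obtain u where u: "g (P (x u) $ j) \<noteq> 0" "u \<noteq> - z1 $ j"
        using eventually_happens[of _ "at (0::complex)"] by auto
      from u(2) have "x u $ j \<noteq> 0"
        by (simp add: x_def add_eq_0_iff)
      with u(1) show ?thesis unfolding p1F by (intro exI[of _ "x u"]) simp
    qed
    moreover have "exp 1 ^ N * graph_max F p1 r \<le> graph_max F p1 (exp 1 * r)" if r: "r > 0" for r
    proof -
      \<comment> \<open>On the line \<open>u * z\<close>, the value at \<open>u = 1\<close> is the
        maximum over the small ball, and \<open>cmod u = exp 1\<close> stays in the large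
        ball.\<close>
      obtain z where z: "norm z \<le> r" "cmod (cpoly_eval p1 (graph_point F z)) = graph_max F p1 r"
        using graph_max_attained(1)[OF contF] r by (meson less_imp_le)
      define x where "x = (\<lambda>u. \<chi> i. u * z $ i)"
      define \<pi> where "\<pi> = (\<lambda>u. P (x u) $ j - c)"
      define \<psi> where "\<psi> = (\<lambda>u. cpoly_eval p1 (graph_point F (x u)))"
      have xhol: "(\<lambda>u. x u $ i) holomorphic_on UNIV" for i
        by (auto simp: x_def intro!: holomorphic_intros)
      have x01: "x 0 = 0" "x 1 = z" by (auto simp: x_def vec_eq_iff)
      have normx: "norm (x u) = cmod u * norm z" for u
        unfolding x_def norm_vec_def by (simp add: norm_mult L2_set_right_distrib)
      have "\<pi> holomorphic_on UNIV" "\<pi> 0 = 0"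
        unfolding \<pi>_def by (intro holomorphic_intros holP xhol) (simp add: x01 c_def)
      from entire_zero_linear_bound[OF this] obtain B where
        B: "B \<ge> 0" "\<And>u. cmod u \<le> 1 \<Longrightarrow> cmod (\<pi> u) \<le> B * cmod u"
        by blast
      have \<psi>: "\<psi> = (\<lambda>u. (u * z $ j) ^ t * g (P (x u) $ j))"
        unfolding \<psi>_def p1F by (simp add: x_def)
      have "exp 1 ^ N * cmod (\<psi> 1) \<le> graph_max F p1 (exp 1 * r)"
      proof (rule entire_growth_of_zero)
        show "\<psi> holomorphic_on UNIV"
          unfolding \<psi> by (intro holomorphic_intros holg holP xhol)
        \<comment> \<open>For \<open>cmod u\<close> below this radius both \<open>cmod u\<close> and
          \<open>B * cmod u\<close> are at most 1, so the curve stays in the unit disc about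
          \<open>c\<close> on which \<open>g\<close> is estimated.\<close>
        show "1 / (B + 1) > 0" "(exp 1 :: real) \<ge> 1" using B(1) by auto
        fix u assume u: "cmod u < 1 / (B + 1)"
        have Bu: "cmod u * (B + 1) < 1"
          using u B(1) by (simp add: field_simps)
        have u1: "cmod u \<le> 1"
          using Bu mult_nonneg_nonneg[OF norm_ge_zero[of u] B(1)] by (simp add: distrib_left)
        have "B * cmod u \<le> 1"
          using Bu norm_ge_zero[of u] by (simp add: algebra_simps del: norm_ge_zero)
        then have "cmod (\<pi> u) \<le> 1" using B(2)[OF u1] by linarith
        then have "P (x u) $ j \<in> cball c 1"
          by (simp add: \<pi>_def dist_norm norm_minus_commute)
        from C(2)[OF this] have "cmod (g (P (x u) $ j)) \<le> C * cmod (\<pi> u) ^ (N - 1)"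
          by (simp add: g_def \<pi>_def)
        also have "\<dots> \<le> C * (B * cmod u) ^ (N - 1)"
          using C(1) B(2)[OF u1] by (intro mult_left_mono power_mono) auto
        finally have 1: "cmod (g (P (x u) $ j)) \<le> C * B ^ (N - 1) * cmod u ^ (N - 1)"
          by (simp add: power_mult_distrib mult.assoc)
        have "cmod u ^ t \<le> cmod u ^ 1"
          using t(1) u1 by (intro power_decreasing) auto
        then have 2: "cmod ((u * z $ j) ^ t) \<le> cmod u * cmod (z $ j) ^ t"
          by (simp add: norm_power norm_mult power_mult_distrib mult_right_mono)
        have "cmod (\<psi> u) \<le> (cmod u * cmod (z $ j) ^ t) * (C * B ^ (N - 1) * cmod u ^ (N - 1))"
          unfolding \<psi> norm_mult[of "_ ^ t"] by (intro mult_mono 1 2) auto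
        also have "\<dots> = (cmod (z $ j) ^ t * C * B ^ (N - 1)) * (cmod u * cmod u ^ (N - 1))"
          by (simp only: mult_ac)
        also have "cmod u * cmod u ^ (N - 1) = cmod u ^ N"
          using N(2) by (metis power_minus_mult mult.commute less_eq_Suc_le One_nat_def)
        finally show "cmod (\<psi> u) \<le> (cmod (z $ j) ^ t * C * B ^ (N - 1)) * cmod u ^ N" .
      next
        fix u assume "cmod u = exp 1"
        then have "norm (x u) \<le> exp 1 * r"
          using z(1) by (simp add: normx)
        then show "cmod (\<psi> u) \<le> graph_max F p1 (exp 1 * r)"
          unfolding \<psi>_def using graph_max_attained(2)[OF contF] r by simp
      qed
      then show ?thesis
        by (simp add: \<psi>_def x01 z(2))
    qed
    ultimately show ?thesis
      using p1(1) unfolding N_def K_def by blast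
  qed
  moreover have "E \<ge> 1" using D(1) by (simp add: E_def)
  ultimately show ?thesis
    unfolding F_def by blast
qed

text \<open>If the maximum at radius \<open>r\<close> were 0, the Bernstein type inequality would
  propagate the zero to the radii \<open>exp 1 ^ n * r\<close>, which reach every point. This allows
  division by the maximum later.\<close>

lemma graph_max_pos:
  assumes F: "continuous_on UNIV F" and adm: "admits_bernstein F \<mu>"
    and nz: "cpoly_eval p (graph_point F z) \<noteq> 0" and r: "r > 0"
  shows "graph_max F p r > 0"
proof (rule ccontr)
  assume "\<not> graph_max F p r > 0"
  then have 0: "graph_max F p r = 0"
    using graph_max_nonneg[OF F, of r p] r by simp
  have step: "graph_max F p (exp 1 * r) = 0" if r: "r > 0" and 0: "graph_max F p r = 0" for r
  proof -
    obtain C where "graph_max F p (exp 1 * r) \<le> C powr \<mu> (cpoly_degree p) * graph_max F p r"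
      using adm r unfolding admits_bernstein_def by blast
    with 0 show ?thesis
      using graph_max_nonneg[OF F, of "exp 1 * r" p] r by simp
  qed
  have all: "graph_max F p (exp 1 ^ n * r) = 0" for n
  proof (induction n)
    case (Suc n)
    from step[OF _ this] r show ?case by (simp add: mult.assoc)
  qed (simp add: 0)
  obtain n where n: "norm z / r < exp 1 ^ n"
    using real_arch_pow[of "exp 1" "norm z / r"] by auto
  then have "norm z \<le> exp 1 ^ n * r"
    using r by (simp add: field_simps)
  from graph_max_attained(2)[OF F _ this, of p] all[of n] nz r show False
    by simp
qed

lemma optimal_exponent_exp_map:
  fixes J :: "'m::finite \<Rightarrow> 'l::finite"
  assumes P: "polynomial_automorphism P" and Q: "polynomial_automorphism Q"
    and indep: "inj_on \<alpha> {s. J s = j}" "complex_over_rat.independent (\<alpha> ` {s. J s = j})"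
    and m: "card {s. J s = j} = m" "\<And>j. card {s. J s = j} \<le> m"
  shows "optimal_exponent (Q \<circ> exp_map \<alpha> J \<circ> P) (\<lambda>k. real (k ^ (m + 1)))"
  unfolding optimal_exponent_def
proof (intro conjI allI impI)
  show "admits_bernstein (Q \<circ> exp_map \<alpha> J \<circ> P) (\<lambda>k. real (k ^ (m + 1)))"
    by (rule admits_bernstein_exp_map[OF P Q m(2)])
  fix \<mu> assume "admits_bernstein (Q \<circ> exp_map \<alpha> J \<circ> P) \<mu> \<and> exponent_le \<mu> (\<lambda>k. real (k ^ (m + 1)))"
  define F where "F = Q \<circ> exp_map \<alpha> J \<circ> P"
  have adm: "admits_bernstein F \<mu>"
    and le: "exponent_le \<mu> (\<lambda>k. real (k ^ (m + 1)))"
    using \<open>_ \<and> _\<close> by (auto simp: F_def)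
  have contF: "continuous_on UNIV F"
    unfolding F_def using P Q
    by (intro continuous_on_compose continuous_on_exp_map continuous_on_polynomial_map)
      (simp_all add: polynomial_automorphism_def)
  have \<mu>0: "\<mu> k \<ge> 0" for k using adm by (simp add: admits_bernstein_def)
  obtain C where C: "C \<ge> 0" "\<And>p. graph_max F p (exp 1 * 1) \<le> C powr \<mu> (cpoly_degree p) * graph_max F p 1"
    using adm zero_less_one unfolding admits_bernstein_def by blast
  obtain E where E: "E \<ge> 1" "\<And>k. k \<ge> 1 \<Longrightarrow> \<exists>p. cpoly_degree p = k \<and>
    (\<exists>z. cpoly_eval p (graph_point F z) \<noteq> 0) \<and>
    (\<forall>r>0. exp 1 ^ (((k - 1) div E + 1) ^ (m + 1)) * graph_max F p r \<le> graph_max F p (exp 1 * r))"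
    using ex_poly_large_growth[OF P Q indep m(1)] unfolding F_def by blast
  \<comment> \<open>\<open>ln C\<close> may be nonpositive; the maximum with 1 keeps the constant
    positive.\<close>
  define c2 where "c2 = real (E ^ (m + 1)) * max 1 (ln C)"
  have c2: "c2 > 0" using E(1) by (auto simp: c2_def intro!: mult_pos_pos)
  have lower: "real (k ^ (m + 1)) \<le> c2 * \<mu> k" for k
  proof (cases "k \<ge> 1")
    case True
    define N where "N = ((k - 1) div E + 1) ^ (m + 1)"
    obtain p z where p: "cpoly_degree p = k" "cpoly_eval p (graph_point F z) \<noteq> 0"
      "exp 1 ^ N * graph_max F p 1 \<le> graph_max F p (exp 1 * 1)"
      using E(2)[OF True] zero_less_one unfolding N_def by blast
    have pos: "graph_max F p 1 > 0"
      by (rule graph_max_pos[OF contF adm p(2)]) simp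
    have "exp 1 ^ N * graph_max F p 1 \<le> C powr \<mu> k * graph_max F p 1"
      using p(3) C(2)[of p] unfolding p(1) by (rule order_trans)
    then have *: "exp 1 ^ N \<le> C powr \<mu> k"
      using pos by simp
    \<comment> \<open>\<open>0 powr \<mu> k\<close> is 0, which would contradict the lower bound;
      this case must go before writing \<open>powr\<close> as an exponential.\<close>
    then have "C \<noteq> 0"
      using not_le[of "exp (1::real) ^ N" 0] by auto
    then have "C powr \<mu> k = exp (\<mu> k * ln C)"
      by (simp add: powr_def)
    then have "exp (real N) \<le> exp (\<mu> k * ln C)"
      using * by (simp add: exp_of_nat_mult[symmetric])
    then have "real N \<le> \<mu> k * ln C"
      by simp
    also have "\<dots> \<le> \<mu> k * max 1 (ln C)"
      by (intro mult_left_mono \<mu>0) simp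
    finally have N: "real N \<le> \<mu> k * max 1 (ln C)" .
    have "k - 1 < E * ((k - 1) div E + 1)"
      using E(1) dividend_less_times_div[of E "k - 1"] by simp
    then have "k \<le> E * ((k - 1) div E + 1)"
      by linarith
    then have "k ^ (m + 1) \<le> (E * ((k - 1) div E + 1)) ^ (m + 1)"
      by (rule power_mono) simp
    also have "\<dots> = E ^ (m + 1) * N"
      by (simp only: power_mult_distrib N_def)
    finally have "real (k ^ (m + 1)) \<le> real (E ^ (m + 1)) * real N"
      by (metis of_nat_le_iff of_nat_mult)
    also have "\<dots> \<le> real (E ^ (m + 1)) * (\<mu> k * max 1 (ln C))"
      by (intro mult_left_mono N) simp
    finally show ?thesis by (simp only: c2_def mult_ac)
  next
    case False
    then have "k = 0" by simp
    then show ?thesis using c2 \<mu>0[of k] by simp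
  qed
  obtain c1 where c1: "c1 > 0" "\<And>k. \<mu> k \<le> c1 * real (k ^ (m + 1))"
    using le unfolding exponent_le_def by blast
  define c where "c = max c1 c2"
  have c: "c > 0" using c2 by (simp add: c_def)
  show "exponent_equiv \<mu> (\<lambda>k. real (k ^ (m + 1)))"
    unfolding exponent_equiv_def
  proof (intro exI[of _ c] conjI allI c)
    fix k
    have "\<mu> k \<le> c * real (k ^ (m + 1))"
      by (rule order_trans[OF c1(2)]) (intro mult_right_mono, auto simp: c_def)
    then show "1 / c * \<mu> k \<le> real (k ^ (m + 1))"
      using c by (simp add: field_simps)
    show "real (k ^ (m + 1)) \<le> c * \<mu> k"
      by (rule order_trans[OF lower]) (intro mult_right_mono \<mu>0, simp add: c_def)
  qed
qed

section \<open>From product maps to exponential maps with grouped coordinates\<close>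

theorem theorem1p4:
  fixes m :: "'l::finite \<Rightarrow> nat"
    and coord :: "'m::finite \<Rightarrow> 'l \<times> nat"
    and f :: "'l \<Rightarrow> complex \<Rightarrow> nat \<Rightarrow> complex"
    and P :: "complex ^ 'l \<Rightarrow> complex ^ 'l"
    and Q :: "complex ^ 'm \<Rightarrow> complex ^ 'm"
  assumes "\<And>j. 1 \<le> m j"
    and "bij_betw coord UNIV (SIGMA j:UNIV. {..<m j})"
    and "\<And>j. exponential_max_trdeg (m j) (f j)"
    and "polynomial_automorphism P"
    and "polynomial_automorphism Q"
  shows "admits_bernstein (Q \<circ> product_map coord f \<circ> P) (\<lambda>k. real (k ^ (Max (range m) + 1)))
       \<and> optimal_exponent (Q \<circ> product_map coord f \<circ> P) (\<lambda>k. real (k ^ (Max (range m) + 1)))"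
proof -
  obtain \<beta> where \<beta>: "\<And>j. inj_on (\<beta> j) {..<m j}"
    "\<And>j. complex_over_rat.independent (\<beta> j ` {..<m j})"
    "\<And>j z i. i < m j \<Longrightarrow> f j z i = exp (\<beta> j i * z)"
    using assms(3) unfolding exponential_max_trdeg_def by metis
  \<comment> \<open>\<open>coord s\<close> consists of the factor to which coordinate
    \<open>s\<close> belongs and its place there; this gives the variable \<open>J s\<close> and the
    frequency \<open>\<alpha> s\<close>.\<close>
  define J where "J = (\<lambda>s. fst (coord s))"
  define \<alpha> where "\<alpha> = (\<lambda>s. \<beta> (J s) (snd (coord s)))"
  have lt: "snd (coord s) < m (J s)" for s
  proof -
    have "coord s \<in> (SIGMA j:UNIV. {..<m j})"
      using bij_betwE[OF assms(2)] by blast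
    then show ?thesis
      by (cases "coord s") (simp add: J_def)
  qed
  have "product_map coord f = exp_map \<alpha> J"
    using lt by (auto simp: fun_eq_iff product_map_def exp_map_def vec_eq_iff \<alpha>_def J_def \<beta>(3) split: prod.split)
      (metis \<beta>(3) fst_conv snd_conv)
  moreover have bij: "bij_betw (snd \<circ> coord) {s. J s = j} {..<m j}" for j
  proof (rule bij_betwI')
    fix s t assume "s \<in> {s. J s = j}" "t \<in> {s. J s = j}"
    then show "(snd \<circ> coord) s = (snd \<circ> coord) t \<longleftrightarrow> s = t"
      using inj_eq[OF bij_betw_imp_inj_on[OF assms(2)], of s t] by (auto simp: J_def prod_eq_iff)
  next
    fix s assume "s \<in> {s. J s = j}"
    then show "(snd \<circ> coord) s \<in> {..<m j}" using lt[of s] by auto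
  next
    fix i assume "i \<in> {..<m j}"
    then have "(j, i) \<in> coord ` UNIV"
      using bij_betw_imp_surj_on[OF assms(2)] by auto
    then obtain s where "coord s = (j, i)" by (metis imageE)
    then show "\<exists>s\<in>{s. J s = j}. i = (snd \<circ> coord) s"
      by (intro bexI[of _ s]) (auto simp: J_def)
  qed
  have card: "card {s. J s = j} = m j" for j
    using bij_betw_same_card[OF bij[of j]] by simp
  have "Max (range m) \<in> range m"
    by (rule Max_in) auto
  \<comment> \<open>A factor of largest dimension supplies the lower bound; all fibres of
    \<open>J\<close> are no larger, which gives the upper bound.\<close>
  then obtain j where j: "Max (range m) = m j" by (rule rangeE)
  have m_le: "m i \<le> m j" for i
    unfolding j[symmetric] by simp
  have img: "\<alpha> ` {s. J s = j} = \<beta> j ` {..<m j}"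
    unfolding bij_betw_imp_surj_on[OF bij, symmetric] by (auto simp: \<alpha>_def image_iff)
  have "inj_on (\<beta> j \<circ> (snd \<circ> coord)) {s. J s = j}"
    using \<beta>(1)[of j] bij_betw_imp_inj_on[OF bij] bij_betw_imp_surj_on[OF bij]
    by (metis comp_inj_on)
  then have "inj_on \<alpha> {s. J s = j}"
    by (rule inj_on_cong[THEN iffD1, rotated]) (simp add: \<alpha>_def)
  with \<beta>(2) have "optimal_exponent (Q \<circ> exp_map \<alpha> J \<circ> P) (\<lambda>k. real (k ^ (Max (range m) + 1)))"
    by (intro optimal_exponent_exp_map[where j = j] assms) (auto simp: img card j m_le)
  ultimately show ?thesis
    unfolding optimal_exponent_def by metis
qed

end
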